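(* Let $n$ be an even positive integer, and suppose $u$ is an axially symmetric smooth solution of $$\frac{1}{n+1}P_nu=(n-1)!\,(e^{nu}-1)\qquad\text{on }\mathbb{S}^n.$$ Then $u=0$ on $\mathbb{S}^n$.
   Context: $\mathbb{S}^n$ is the unit sphere in $\mathbb{R}^{n+1}$ with the round metric and Laplace–Beltrami operator $\Delta_{\mathbb{S}^n}$ (nonpositive). For $n$ even, the GJMS operator in critical dimension is $P_n=\prod_{j=0}^{(n-2)/2}\big(-\Delta_{\mathbb{S}^n}+j(n-1-j)\big)$. A function $u$ on $\mathbb{S}^n$ is axially symmetric if there is a unit vector $e\in\mathbb{R}^{n+1}$ such that $u(\xi)$ depends only on $\langle\xi,e\rangle$. *)

theory Defs
  imports "HOL-Analysis.Analysis"
begin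

text \<open>\<open>C\<^sup>k\<close> functions on an open subset of a normed space, via iterated directional derivatives.\<close>

primrec Ck_on :: "nat \<Rightarrow> 'a::real_normed_vector set \<Rightarrow> ('a \<Rightarrow> 'b::real_normed_vector) \<Rightarrow> bool" where
  "Ck_on 0 S f \<longleftrightarrow> continuous_on S f"
| "Ck_on (Suc k) S f \<longleftrightarrow> (\<forall>x\<in>S. f differentiable (at x)) \<and>
     (\<forall>v. Ck_on k S (\<lambda>x. frechet_derivative f (at x) v))"

definition smooth_on_open :: "'a::real_normed_vector set \<Rightarrow> ('a \<Rightarrow> 'b::real_normed_vector) \<Rightarrow> bool" where
  "smooth_on_open S f \<longleftrightarrow> open S \<and> (\<forall>k. Ck_on k S f)"

text \<open>A function on a subset of Euclidean space is smooth if locally it is the restriction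
  of a smooth function defined on an open set of the ambient space.
  For the sphere this agrees with smoothness in charts.\<close>

definition smooth_on_sphere :: "('a::euclidean_space \<Rightarrow> real) \<Rightarrow> bool" where
  "smooth_on_sphere u \<longleftrightarrow> (\<forall>\<xi>\<in>sphere 0 1. \<exists>U F. \<xi> \<in> U \<and> smooth_on_open U F \<and>
     (\<forall>x\<in>U \<inter> sphere 0 1. F x = u x))"

text \<open>Functions and vector fields on the unit sphere are functions on the ambient space,
  of which only the values on the sphere matter.

  A derivative within the sphere at \<open>\<xi>\<close> is determined on the tangent space, the orthogonal
  complement of \<open>\<xi>\<close>, and arbitrary on \<open>\<xi>\<close>; \<open>D \<xi> = 0\<close> normalises it, so
  that \<open>D\<close> is the differential on the tangent space composed with the orthogonal projection.\<close>

definition sphere_deriv :: "('a::euclidean_space \<Rightarrow> 'b::real_normed_vector) \<Rightarrow> 'a \<Rightarrow> 'a \<Rightarrow> 'b" where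
  "sphere_deriv f \<xi> = (THE D. (f has_derivative D) (at \<xi> within sphere 0 1) \<and> D \<xi> = 0)"

lemma sphere_deriv_unique:
  fixes f :: "'a::euclidean_space \<Rightarrow> 'b::real_normed_vector"
  assumes "\<xi> \<in> sphere 0 1"
    and D: "(f has_derivative D) (at \<xi> within sphere 0 1)" "D \<xi> = 0"
    and E: "(f has_derivative E) (at \<xi> within sphere 0 1)" "E \<xi> = 0"
  shows "D = E"
proof
  fix h
  have [simp]: "\<xi> \<bullet> \<xi> = 1" using assms(1) by (simp add: dot_square_norm)
  interpret D: bounded_linear D using D(1) by (rule has_derivative_bounded_linear)
  interpret E: bounded_linear E using E(1) by (rule has_derivative_bounded_linear)
  have unit: "D v = E v" if v: "v \<bullet> \<xi> = 0" "norm v = 1" for v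
  proof -
    define c where "c = (\<lambda>t. cos t *\<^sub>R \<xi> + sin t *\<^sub>R v)"
    have "v \<bullet> v = 1" using v by (simp add: dot_square_norm)
    then have "c t \<bullet> c t = 1" for t
      using v sin_cos_squared_add[of t]
      by (simp add: c_def algebra_simps inner_commute power2_eq_square)
    then have img: "c ` UNIV \<subseteq> sphere 0 1" by (auto simp: norm_eq_1)
    have c: "(c has_derivative (\<lambda>t. t *\<^sub>R v)) (at 0)"
      unfolding c_def by (auto intro!: derivative_eq_intros)
    have c0: "c 0 = \<xi>" by (simp add: c_def)
    have "(f \<circ> c has_derivative D \<circ> (\<lambda>t. t *\<^sub>R v)) (at 0)"
      using diff_chain_within[OF c, of f D]  has_derivative_subset[OF D(1) img] by (simp add: c0)
    moreover have "(f \<circ> c has_derivative E \<circ> (\<lambda>t. t *\<^sub>R v)) (at 0)"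
      using diff_chain_within[OF c, of f E]  has_derivative_subset[OF E(1) img] by (simp add: c0)
    ultimately have "D \<circ> (\<lambda>t. t *\<^sub>R v) = E \<circ> (\<lambda>t. t *\<^sub>R v)" by (rule has_derivative_unique)
    then show ?thesis by (metis comp_apply scaleR_one)
  qed
  have tang: "D v = E v" if "v \<bullet> \<xi> = 0" for v
  proof (cases "v = 0")
    case False
    then have "D (v /\<^sub>R norm v) = E (v /\<^sub>R norm v)" using that by (intro unit) auto
    with False show ?thesis by (simp add: D.scaleR E.scaleR)
  qed (simp add: D.zero E.zero)
  define w where "w = h - (h \<bullet> \<xi>) *\<^sub>R \<xi>"
  have "h = w + (h \<bullet> \<xi>) *\<^sub>R \<xi>" by (simp add: w_def)
  moreover have "D w = E w" by (rule tang) (simp add: w_def inner_diff_left)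
  ultimately show "D h = E h"
    by (metis D.add D.scaleR E.add E.scaleR D(2) E(2))
qed

lemma sphere_deriv_eqI:
  assumes "\<xi> \<in> sphere 0 1" "(f has_derivative D) (at \<xi> within sphere 0 1)" "D \<xi> = 0"
  shows "sphere_deriv f \<xi> = D"
  unfolding sphere_deriv_def using assms sphere_deriv_unique by (intro the_equality) blast+

text \<open>The gradient is the tangent vector representing the differential in the induced metric.\<close>

definition sphere_grad :: "('a::euclidean_space \<Rightarrow> real) \<Rightarrow> 'a \<Rightarrow> 'a" where
  "sphere_grad f \<xi> = (\<Sum>b\<in>Basis. sphere_deriv f \<xi> b *\<^sub>R b)"

text \<open>The covariant derivative of the induced metric is the tangential part of the ambient
  derivative, and the divergence is its trace. As \<open>sphere_deriv X \<xi> \<xi> = 0\<close>,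
  the trace over the ambient space equals the trace over the tangent space.\<close>

definition sphere_div :: "('a::euclidean_space \<Rightarrow> 'a) \<Rightarrow> 'a \<Rightarrow> real" where
  "sphere_div X \<xi> = (\<Sum>b\<in>Basis. sphere_deriv X \<xi> b \<bullet> b)"

definition sphere_laplacian :: "('a::euclidean_space \<Rightarrow> real) \<Rightarrow> 'a \<Rightarrow> real" where
  "sphere_laplacian f = sphere_div (sphere_grad f)"

text \<open>The product of operators is composition; the factors commute on smooth functions.
  For even \<open>n \<ge> 2\<close> the list \<open>[0..<n div 2]\<close> is \<open>0, \<dots>, (n - 2) / 2\<close>.\<close>

definition gjms_factor :: "nat \<Rightarrow> nat \<Rightarrow> ('a::euclidean_space \<Rightarrow> real) \<Rightarrow> 'a \<Rightarrow> real" where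
  "gjms_factor n j u = (\<lambda>\<xi>. - sphere_laplacian u \<xi> + real j * (real n - 1 - real j) * u \<xi>)"

definition gjms :: "nat \<Rightarrow> ('a::euclidean_space \<Rightarrow> real) \<Rightarrow> 'a \<Rightarrow> real" where
  "gjms n u = foldr (gjms_factor n) [0..<n div 2] u"

definition axially_symmetric :: "('a::euclidean_space \<Rightarrow> real) \<Rightarrow> bool" where
  "axially_symmetric u \<longleftrightarrow>
     (\<exists>e f. norm e = 1 \<and> (\<forall>\<xi>\<in>sphere 0 1. u \<xi> = f (\<xi> \<bullet> e)))"

end

theory Submission
  imports Defs
begin

text \<open>Write \<open>n = 2m\<close>, \<open>x = \<langle>\<xi>, e\<rangle>\<close>, \<open>u = f(x)\<close>, \<open>p = 1 - x\<^sup>2\<close> and \<open>W = p\<^sup>m f'\<close>.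
  On zonal functions \<open>P\<^sub>n f = (-1)\<^sup>m D\<^bsup>2m-1\<^esup> W\<close>, so differentiating the equation and multiplying by
  \<open>p\<^sup>m\<close> gives \<open>p\<^sup>m D\<^bsup>2m\<^esup> W = n W D\<^bsup>2m-1\<^esup> W + (-1)\<^sup>m (n+1)! W\<close>.
  Multiply by \<open>x\<close> and integrate over \<open>(-1,1)\<close>. As \<open>D\<^bsup>2m\<^esup> (x p\<^sup>m) = (-1)\<^sup>m (n+1)! x\<close>, the linear terms
  cancel (here the factor \<open>1/(n+1)\<close> enters) and \<open>\<integral> x W D\<^bsup>2m-1\<^esup> W = 0\<close> remains; by parts this is
  \<open>(-1)\<^sup>m (m - 1/2) \<integral> (D\<^bsup>m-1\<^esup> W)\<^sup>2\<close>. Hence \<open>D\<^bsup>m-1\<^esup> W = 0\<close>, so \<open>W = 0\<close>, and \<open>u\<close> is constant.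

  Instead of integrating, an explicit primitive (\<open>flux\<close>) is shown to be monotone and to vanish at both ends.\<close>

section \<open>Smooth functions of a real variable\<close>

text \<open>Continuity of the top derivative is not demanded, so \<open>k = 0\<close> is vacuous and
  inductions start for free; quantified over all \<open>k\<close> on an open set this is ordinary
  smoothness.\<close>

definition Cdiff :: "nat \<Rightarrow> real set \<Rightarrow> (real \<Rightarrow> real) \<Rightarrow> bool" where
  "Cdiff k S f \<longleftrightarrow> (\<forall>j<k. \<forall>x\<in>S. (deriv ^^ j) f differentiable (at x))"

definition smooth :: "real set \<Rightarrow> (real \<Rightarrow> real) \<Rightarrow> bool" where
  "smooth S f \<longleftrightarrow> (\<forall>k. Cdiff k S f)"

lemma Cdiff_0 [simp]: "Cdiff 0 S f"
  by (simp add: Cdiff_def)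

lemma Cdiff_Suc: "Cdiff (Suc k) S f \<longleftrightarrow> (\<forall>x\<in>S. f differentiable (at x)) \<and> Cdiff k S (deriv f)"
  unfolding Cdiff_def All_less_Suc2 funpow_Suc_right by simp

lemma Cdiff_Suc_imp: "Cdiff (Suc k) S f \<Longrightarrow> Cdiff k S f"
  by (simp add: Cdiff_def)

text \<open>All derivatives are taken with respect to the whole line, so \<open>Cdiff\<close> is a
  condition on single points of the set.\<close>

lemma Cdiff_local:
  assumes "\<And>x. x \<in> S \<Longrightarrow> \<exists>T. x \<in> T \<and> Cdiff k T f"
  shows "Cdiff k S f"
  unfolding Cdiff_def
proof (intro allI impI ballI)
  fix j x assume "j < k" "x \<in> S"
  moreover obtain T where "x \<in> T" "Cdiff k T f" using assms[OF \<open>x \<in> S\<close>] by blast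
  ultimately show "(deriv ^^ j) f differentiable (at x)" by (simp add: Cdiff_def)
qed

lemma deriv_cong_open:
  fixes f g :: "real \<Rightarrow> real"
  assumes "open S" "\<And>x. x \<in> S \<Longrightarrow> f x = g x" "x \<in> S"
  shows "deriv f x = deriv g x"
proof (rule deriv_cong_ev)
  show "\<forall>\<^sub>F x in nhds x. f x = g x"
    using eventually_nhds_in_open[OF assms(1,3)] by (rule eventually_mono) (rule assms(2))
qed simp

lemma Cdiff_cong:
  assumes "open S" "\<And>x. x \<in> S \<Longrightarrow> f x = g x" "Cdiff k S f"
  shows "Cdiff k S g"
  using assms(2,3)
proof (induction k arbitrary: f g)
  case (Suc k)
  have "g differentiable (at x)" if x: "x \<in> S" for x
  proof -
    have "f differentiable (at x)" using Suc.prems x by (auto simp: Cdiff_Suc)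
    then obtain D where "(f has_derivative D) (at x)" by (auto simp: differentiable_def)
    then have "(g has_derivative D) (at x)"
      by (rule has_derivative_transform_within_open[OF _ assms(1) x]) (simp add: Suc.prems)
    then show ?thesis by (auto simp: differentiable_def)
  qed
  moreover have "Cdiff k S (deriv g)"
  proof (rule Suc.IH)
    show "deriv f x = deriv g x" if "x \<in> S" for x
      using assms(1) Suc.prems(1) that by (rule deriv_cong_open)
    show "Cdiff k S (deriv f)" using Suc.prems(2) by (simp add: Cdiff_Suc)
  qed
  ultimately show ?case by (simp add: Cdiff_Suc)
qed simp

text \<open>Lets an explicit formula \<open>f'\<close> stand for \<open>deriv f\<close>, so later
  inductions run on closed classes of formulas. Openness makes agreement on \<open>S\<close> pass to
  all derivatives.\<close>

lemma Cdiff_SucI: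
  assumes "open S" "\<And>x. x \<in> S \<Longrightarrow> (f has_real_derivative f' x) (at x)" "Cdiff k S f'"
  shows "Cdiff (Suc k) S f"
  unfolding Cdiff_Suc
proof
  show "\<forall>x\<in>S. f differentiable (at x)"
    using assms(2) real_differentiable_def by blast
  show "Cdiff k S (deriv f)"
    by (rule Cdiff_cong[OF assms(1) _ assms(3)]) (rule DERIV_imp_deriv[symmetric, OF assms(2)])
qed

lemma Cdiff_SucD:
  assumes "Cdiff (Suc k) S f" "x \<in> S"
  shows "(f has_real_derivative deriv f x) (at x)"
  using assms by (simp add: Cdiff_Suc DERIV_deriv_iff_real_differentiable)

section \<open>Closure of smooth functions under the ring operations and differentiation\<close>

lemma Cdiff_const: "open S \<Longrightarrow> Cdiff k S (\<lambda>_. c)"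
proof (induction k arbitrary: c)
  case (Suc k)
  show ?case by (rule Cdiff_SucI[OF Suc.prems DERIV_const Suc.IH[OF Suc.prems]])
qed simp

lemma Cdiff_ident: "open S \<Longrightarrow> Cdiff k S (\<lambda>x. x)"
  by (cases k) (auto intro: Cdiff_SucI[OF _ DERIV_ident Cdiff_const])

lemma Cdiff_add:
  assumes "open S" "Cdiff k S f" "Cdiff k S g"
  shows "Cdiff k S (\<lambda>x. f x + g x)"
  using assms(2,3)
proof (induction k arbitrary: f g)
  case (Suc k)
  have "Cdiff k S (\<lambda>x. deriv f x + deriv g x)"
    using Suc.prems by (intro Suc.IH) (simp_all add: Cdiff_Suc)
  then show ?case
    using Suc.prems by (intro Cdiff_SucI[OF assms(1) DERIV_add[OF Cdiff_SucD Cdiff_SucD]])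
qed simp

lemma Cdiff_mult:
  assumes "open S" "Cdiff k S f" "Cdiff k S g"
  shows "Cdiff k S (\<lambda>x. f x * g x)"
  using assms(2,3)
proof (induction k arbitrary: f g)
  case (Suc k)
  note low = Suc.prems[THEN Cdiff_Suc_imp]
  have "Cdiff k S (\<lambda>x. deriv f x * g x + deriv g x * f x)"
    using Suc.prems low by (intro Cdiff_add[OF assms(1)] Suc.IH) (simp_all add: Cdiff_Suc)
  then show ?case
    using Suc.prems by (intro Cdiff_SucI[OF assms(1) DERIV_mult[OF Cdiff_SucD Cdiff_SucD]])
qed simp

lemma smooth_cong: "open S \<Longrightarrow> (\<And>x. x \<in> S \<Longrightarrow> f x = g x) \<Longrightarrow> smooth S f \<Longrightarrow> smooth S g"
  unfolding smooth_def using Cdiff_cong by blast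

lemma smooth_const: "open S \<Longrightarrow> smooth S (\<lambda>_. c)"
  by (simp add: smooth_def Cdiff_const)

lemma smooth_ident: "open S \<Longrightarrow> smooth S (\<lambda>x. x)"
  by (simp add: smooth_def Cdiff_ident)

lemma smooth_add: "open S \<Longrightarrow> smooth S f \<Longrightarrow> smooth S g \<Longrightarrow> smooth S (\<lambda>x. f x + g x)"
  by (simp add: smooth_def Cdiff_add)

lemma smooth_mult: "open S \<Longrightarrow> smooth S f \<Longrightarrow> smooth S g \<Longrightarrow> smooth S (\<lambda>x. f x * g x)"
  by (simp add: smooth_def Cdiff_mult)

lemma smooth_minus: "open S \<Longrightarrow> smooth S f \<Longrightarrow> smooth S (\<lambda>x. - f x)"
  using smooth_mult[of S "\<lambda>_. -1" f] by (simp add: smooth_const)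

lemma smooth_diff: "open S \<Longrightarrow> smooth S f \<Longrightarrow> smooth S g \<Longrightarrow> smooth S (\<lambda>x. f x - g x)"
  using smooth_add[of S f "\<lambda>x. - g x"] by (simp add: smooth_minus)

lemma smooth_deriv: "smooth S f \<Longrightarrow> smooth S (deriv f)"
  unfolding smooth_def using Cdiff_Suc by blast

lemma smooth_has_deriv: "smooth S f \<Longrightarrow> x \<in> S \<Longrightarrow> (f has_real_derivative deriv f x) (at x)"
  unfolding smooth_def using Cdiff_SucD by blast

lemma smooth_continuous_on: "smooth S f \<Longrightarrow> continuous_on S f"
  by (rule continuous_at_imp_continuous_on) (blast intro: DERIV_isCont smooth_has_deriv)

lemma smooth_antideriv:
  assumes "open S" "\<And>x. x \<in> S \<Longrightarrow> (f has_real_derivative f' x) (at x)" "smooth S f'"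
  shows "smooth S f"
  using assms unfolding smooth_def by (blast intro: Cdiff_SucI Cdiff_Suc_imp)

section \<open>Smoothness of the parametrisations of a great circle\<close>

lemma smooth_sin: "smooth UNIV sin" and smooth_cos: "smooth UNIV cos"
proof -
  \<comment> \<open>The span of \<open>sin\<close> and \<open>cos\<close> is closed under
    differentiation, so the induction is over all linear combinations at once.\<close>
  have "Cdiff k UNIV (\<lambda>x::real. a * sin x + b * cos x)" for k a b
  proof (induction k arbitrary: a b)
    case (Suc k)
    show ?case
      by (rule Cdiff_SucI[OF _ _ Suc.IH[of "-b" a]]) (auto intro!: derivative_eq_intros)
  qed simp
  from this[of _ 1 0] this[of _ 0 1] show "smooth UNIV sin" "smooth UNIV cos"
    by (simp_all add: smooth_def)
qed

lemma smooth_sqrt_one_minus_sq: "smooth {-1<..<1} (\<lambda>x. sqrt (1 - x\<^sup>2))"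
proof -
  let ?I = "{-1<..<1::real}" and ?r = "\<lambda>x. 1 / sqrt (1 - x\<^sup>2)"
  have pos: "0 < 1 - x\<^sup>2" if "x \<in> ?I" for x
    using that abs_square_less_1[of x] by (auto simp: abs_less_iff)
  \<comment> \<open>The reciprocal root satisfies r' = x r^3, so \<open>k\<close>-fold
    differentiability of r yields that of r', and r gains one order. The root itself is then (1 -
    x^2) r.\<close>
  have r: "Cdiff k ?I ?r" for k
  proof (induction k)
    case (Suc k)
    have "(?r has_real_derivative x * (?r x * (?r x * ?r x))) (at x)" if "x \<in> ?I" for x
    proof -
      define w where "w = sqrt (1 - x\<^sup>2)"
      have w: "w > 0" using pos[OF that] by (simp add: w_def)
      have "((\<lambda>x. sqrt (1 - x\<^sup>2)) has_real_derivative (- (2 * x)) * (inverse w / 2)) (at x)"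
        using pos[OF that] unfolding w_def by (auto intro!: derivative_eq_intros)
      from DERIV_inverse'[OF this] w show ?thesis
        unfolding w_def[symmetric] by (simp add: inverse_eq_divide field_simps)
    qed
    then show ?case
      by (intro Cdiff_SucI[OF _ _ Cdiff_mult[OF _ Cdiff_ident Cdiff_mult[OF _ Suc.IH Cdiff_mult[OF _ Suc.IH Suc.IH]]]]) auto
  qed simp
  have r': "smooth ?I ?r" using r by (simp add: smooth_def)
  have "smooth ?I (\<lambda>x. (1 - x * x) * ?r x)"
    by (intro smooth_mult smooth_diff smooth_const smooth_ident r' open_greaterThanLessThan)
  then show ?thesis
  proof (rule smooth_cong[OF open_greaterThanLessThan, rotated])
    fix x :: real assume "x \<in> ?I"
    from pos[OF this] have "(1 - x\<^sup>2) / sqrt (1 - x\<^sup>2) = sqrt (1 - x\<^sup>2)"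
      by (intro real_div_sqrt) simp
    then show "(1 - x * x) * ?r x = sqrt (1 - x\<^sup>2)" by (simp add: power2_eq_square)
  qed
qed

text \<open>Along a curve in the plane of \<open>v\<close> and \<open>w\<close> the chain rule
  produces only derivatives of \<open>F\<close> in these two fixed directions. They are covered by
  \<open>Ck_on\<close> one order lower, so the induction hypothesis applies to them.\<close>

lemma Cdiff_compose_plane:
  fixes F :: "'a::real_normed_vector \<Rightarrow> real"
  assumes "open S" and "smooth S a" "smooth S b"
    and "\<And>t. t \<in> S \<Longrightarrow> a t *\<^sub>R v + b t *\<^sub>R w \<in> U" and "Ck_on k U F"
  shows "Cdiff k S (\<lambda>t. F (a t *\<^sub>R v + b t *\<^sub>R w))"
  using assms(5)
proof (induction k arbitrary: F)
  case (Suc k)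
  let ?c = "\<lambda>t. a t *\<^sub>R v + b t *\<^sub>R w" and ?D = "\<lambda>x. frechet_derivative F (at x)"
  let ?F' = "\<lambda>t. deriv a t * ?D (?c t) v + deriv b t * ?D (?c t) w"
  have der: "((\<lambda>t. F (?c t)) has_real_derivative ?F' t) (at t)" if t: "t \<in> S" for t
  proof -
    have F: "(F has_derivative ?D (?c t)) (at (?c t))"
      using Suc.prems assms(4)[OF t] by (auto simp: frechet_derivative_works[symmetric])
    then interpret D: bounded_linear "?D (?c t)" by (rule has_derivative_bounded_linear)
    have "(a has_derivative (\<lambda>h. h * deriv a t)) (at t)" "(b has_derivative (\<lambda>h. h * deriv b t)) (at t)"
      using smooth_has_deriv[OF assms(2) t] smooth_has_deriv[OF assms(3) t]
      by (simp_all add: has_field_derivative_def mult_commute_abs)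
    then have "(?c has_derivative (\<lambda>h. (h * deriv a t) *\<^sub>R v + (h * deriv b t) *\<^sub>R w)) (at t)"
      by (intro has_derivative_add has_derivative_scaleR_left)
    from diff_chain_at[OF this F] show ?thesis
      unfolding has_field_derivative_def o_def
      by (rule has_derivative_eq_rhs) (auto simp: D.add D.scaleR algebra_simps)
  qed
  have "Cdiff k S ?F'"
    using Suc.prems smooth_deriv[OF assms(2)] smooth_deriv[OF assms(3)]
    by (intro Cdiff_add Cdiff_mult assms(1) Suc.IH) (simp_all add: smooth_def)
  with der show ?case by (rule Cdiff_SucI[OF assms(1)])
qed simp

text \<open>Smoothness on the sphere only gives local extensions \<open>F\<close>; near each
  \<open>t\<close> the curve stays in the domain of one of them, and there \<open>u\<close> may be
  replaced by \<open>F\<close>.\<close>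

lemma smooth_sphere_compose:
  fixes u :: "'a::euclidean_space \<Rightarrow> real"
  assumes u: "smooth_on_sphere u" and "open S" and ab: "smooth S a" "smooth S b"
    and sph: "\<And>t. t \<in> S \<Longrightarrow> a t *\<^sub>R v + b t *\<^sub>R w \<in> sphere 0 1"
  shows "smooth S (\<lambda>t. u (a t *\<^sub>R v + b t *\<^sub>R w))"
  unfolding smooth_def
proof (intro allI Cdiff_local)
  fix k t assume t: "t \<in> S"
  let ?c = "\<lambda>t. a t *\<^sub>R v + b t *\<^sub>R w"
  from u[unfolded smooth_on_sphere_def, rule_format, OF sph[OF t]]
  obtain U F where U: "?c t \<in> U" "smooth_on_open U F"
    and F: "\<forall>x\<in>U \<inter> sphere 0 1. F x = u x"
    by (elim exE conjE)
  have "continuous_on S a" "continuous_on S b"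
    using smooth_continuous_on ab by auto
  then have "continuous_on S ?c" by (intro continuous_intros)
  moreover have "open U" using U by (simp add: smooth_on_open_def)
  ultimately have op: "open (S \<inter> ?c -` U)"
    by (rule continuous_open_preimage[OF _ \<open>open S\<close>])
  have "Cdiff k (S \<inter> ?c -` U) (\<lambda>t. F (?c t))"
  proof (rule Cdiff_compose_plane[OF op])
    show "smooth (S \<inter> ?c -` U) a" "smooth (S \<inter> ?c -` U) b"
      using ab by (simp_all add: smooth_def Cdiff_def)
    show "Ck_on k U F" using U by (simp add: smooth_on_open_def)
  qed simp
  moreover have "F (?c t) = u (?c t)" if "t \<in> S \<inter> ?c -` U" for t
    using that sph[of t] F by simp
  ultimately have "Cdiff k (S \<inter> ?c -` U) (\<lambda>t. u (?c t))"
    by (rule Cdiff_cong[OF op, rotated])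
  with t U(1) show "\<exists>T. t \<in> T \<and> Cdiff k T (\<lambda>t. u (?c t))"
    by (intro exI[of _ "S \<inter> ?c -` U"]) simp
qed

section \<open>Zonal functions on the sphere\<close>

text \<open>Makes the intrinsic derivative computable from any local extension: the result is
  \<open>F'\<close> composed with the orthogonal projection to the tangent space.\<close>

lemma sphere_deriv_extension:
  fixes f F :: "'a::euclidean_space \<Rightarrow> 'b::real_normed_vector"
  assumes \<xi>: "\<xi> \<in> sphere 0 1" and A: "open A" "\<xi> \<in> A"
    and eq: "\<And>x. x \<in> A \<inter> sphere 0 1 \<Longrightarrow> f x = F x"
    and F: "(F has_derivative F') (at \<xi>)"
  shows "sphere_deriv f \<xi> = (\<lambda>h. F' h - (h \<bullet> \<xi>) *\<^sub>R F' \<xi>)"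
proof (rule sphere_deriv_eqI[OF \<xi>])
  have [simp]: "\<xi> \<bullet> \<xi> = 1" using \<xi> by (simp add: dot_square_norm)
  let ?D = "\<lambda>h. F' h - (h \<bullet> \<xi>) *\<^sub>R F' \<xi>"
  \<comment> \<open>Subtracting a multiple of the defining function of the sphere removes the radial derivative.\<close>
  let ?G = "\<lambda>x. F x - ((x \<bullet> x - 1) / 2) *\<^sub>R F' \<xi>"
  have "((\<lambda>x. ((x \<bullet> x - 1) / 2) *\<^sub>R F' \<xi>) has_derivative (\<lambda>h. ((h \<bullet> \<xi>)) *\<^sub>R F' \<xi>)) (at \<xi>)"
    by (auto intro!: derivative_eq_intros simp: inner_commute)
  then have "(?G has_derivative ?D) (at \<xi>)"
    using F by (rule has_derivative_diff[rotated])
  then have G: "(?G has_derivative ?D) (at \<xi> within sphere 0 1)"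
    by (rule has_derivative_at_withinI)
  from A obtain d where d: "d > 0" "ball \<xi> d \<subseteq> A" by (meson openE)
  have "?G x = f x" if "x \<in> sphere 0 1" "dist x \<xi> < d" for x
  proof -
    have "x \<bullet> x = 1" using that by (simp add: dot_square_norm)
    moreover have "x \<in> A" using that d by (auto simp: dist_commute)
    ultimately show ?thesis using eq that by simp
  qed
  then show "(f has_derivative ?D) (at \<xi> within sphere 0 1)"
    by (intro has_derivative_transform_within[OF G d(1) \<xi>]) simp
  show "?D \<xi> = 0" by simp
qed

text \<open>The poles are left out, so that only the values of the profile on the open interval
  matter, where its smoothness is directly available.\<close>

definition zonal :: "'a::euclidean_space \<Rightarrow> ('a \<Rightarrow> real) \<Rightarrow> (real \<Rightarrow> real) \<Rightarrow> bool" where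
  "zonal e u f \<longleftrightarrow> (\<forall>\<xi>\<in>sphere 0 1. \<xi> \<bullet> e \<in> {-1<..<1} \<longrightarrow> u \<xi> = f (\<xi> \<bullet> e))"

text \<open>The gradient is f'(x) (e - x y) at a point y of height x. This formula also defines a
  vector field on the ambient slab, whose projected derivative is then traced.\<close>

lemma sphere_laplacian_zonal:
  fixes u :: "'a::euclidean_space \<Rightarrow> real" and e :: 'a
  assumes e: "norm e = 1" and f: "smooth {-1<..<1} f"
    and u: "zonal e u f"
    and \<xi>: "\<xi> \<in> sphere 0 1" "\<xi> \<bullet> e \<in> {-1<..<1}"
  shows "sphere_laplacian u \<xi> = (1 - (\<xi> \<bullet> e)\<^sup>2) * deriv (deriv f) (\<xi> \<bullet> e)
    - (real DIM('a) - 1) * (\<xi> \<bullet> e) * deriv f (\<xi> \<bullet> e)"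
proof -
  let ?A = "{\<xi>. \<xi> \<bullet> e \<in> {-1<..<1}}"
  have A: "open ?A"
  proof -
    have "?A = (\<lambda>\<xi>. \<xi> \<bullet> e) -` {-1<..<1}" by auto
    then show ?thesis
      by (simp only:) (intro open_vimage open_greaterThanLessThan continuous_intros)
  qed
  have inner: "((\<lambda>z. z \<bullet> e) has_derivative (\<lambda>h. h \<bullet> e)) (at y)" for y
    by (auto intro!: derivative_eq_intros)
  have chain: "((\<lambda>z. g (z \<bullet> e)) has_derivative (\<lambda>h. deriv g (y \<bullet> e) * (h \<bullet> e))) (at y)"
    if "smooth {-1<..<1} g" "y \<in> ?A" for g y
  proof -
    have "(g has_real_derivative deriv g (y \<bullet> e)) (at (y \<bullet> e))"
      using that smooth_has_deriv by blast
    from diff_chain_at[OF inner this[unfolded has_field_derivative_def]]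
    show ?thesis by (simp add: o_def)
  qed
  define X where "X = (\<lambda>y. deriv f (y \<bullet> e) *\<^sub>R (e - (y \<bullet> e) *\<^sub>R y))"
  have grad: "sphere_grad u y = X y" if y: "y \<in> ?A \<inter> sphere 0 1" for y
  proof -
    have "sphere_deriv u y = (\<lambda>h. deriv f (y \<bullet> e) * (h \<bullet> e) - (h \<bullet> y) *\<^sub>R (deriv f (y \<bullet> e) * (y \<bullet> e)))"
      by (rule sphere_deriv_extension[OF _ A _ _ chain[OF f]]) (use y u in \<open>auto simp: zonal_def\<close>)
    then have "sphere_deriv u y = (\<lambda>h. h \<bullet> X y)"
      by (simp add: X_def inner_diff_right fun_eq_iff algebra_simps)
    then show ?thesis
      by (simp add: sphere_grad_def euclidean_representation inner_commute[of _ "X y"])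
  qed
  let ?x = "\<xi> \<bullet> e"
  let ?D = "\<lambda>h. deriv f ?x *\<^sub>R (- (?x *\<^sub>R h + (h \<bullet> e) *\<^sub>R \<xi>))
              + (deriv (deriv f) ?x * (h \<bullet> e)) *\<^sub>R (e - ?x *\<^sub>R \<xi>)"
  have "((\<lambda>y. e - (y \<bullet> e) *\<^sub>R y) has_derivative (\<lambda>h. 0 - (?x *\<^sub>R h + (h \<bullet> e) *\<^sub>R \<xi>))) (at \<xi>)"
    by (intro has_derivative_diff has_derivative_const has_derivative_scaleR inner has_derivative_ident)
  from has_derivative_scaleR[OF chain[OF smooth_deriv[OF f]] this]
  have "(X has_derivative ?D) (at \<xi>)"
    using \<xi> by (simp add: X_def)
  then have D: "sphere_deriv (sphere_grad u) \<xi> = (\<lambda>h. ?D h - (h \<bullet> \<xi>) *\<^sub>R ?D \<xi>)"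
    by (rule sphere_deriv_extension[OF \<xi>(1) A, rotated 2]) (use \<xi> grad in auto)
  have [simp]: "\<xi> \<bullet> \<xi> = 1" "e \<bullet> e = 1" using \<xi> e by (simp_all add: dot_square_norm)
  \<comment> \<open>The trace of a rank-one map, used for every term below that is not a multiple of
    the identity.\<close>
  have sum_inner: "(\<Sum>b\<in>Basis. (b \<bullet> v) * (w \<bullet> b)) = w \<bullet> v" for v w :: 'a
    by (subst euclidean_inner[of w v]) (simp add: inner_commute mult.commute)
  have "sphere_laplacian u \<xi> = (\<Sum>b\<in>Basis. ?D b \<bullet> b) - (\<Sum>b\<in>Basis. (b \<bullet> \<xi>) * (?D \<xi> \<bullet> b))"
    unfolding sphere_laplacian_def sphere_div_def D
    by (simp only: inner_diff_left inner_scaleR_left sum_subtractf)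
  also have "(\<Sum>b\<in>Basis. (b \<bullet> \<xi>) * (?D \<xi> \<bullet> b)) = ?D \<xi> \<bullet> \<xi>"
    by (rule sum_inner)
  \<comment> \<open>The trace of \<open>?D\<close> contributes DIM + 1 copies of - x f'; removing
    the radial direction takes away two, which leaves the dimension of the sphere.\<close>
  also have "?D \<xi> \<bullet> \<xi> = - 2 * ?x * deriv f ?x"
    by (simp add: inner_diff_left inner_add_left inner_commute[of e \<xi>])
  also have "(\<Sum>b\<in>Basis. ?D b \<bullet> b) = (\<Sum>b\<in>Basis. - deriv f ?x * ?x
        - deriv f ?x * ((b \<bullet> e) * (\<xi> \<bullet> b))
        + deriv (deriv f) ?x * ((b \<bullet> e) * ((e - ?x *\<^sub>R \<xi>) \<bullet> b)))"
    by (intro sum.cong refl) (simp add: inner_diff_left inner_add_left algebra_simps)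
  also have "\<dots> = - real DIM('a) * deriv f ?x * ?x - deriv f ?x * ?x
       + deriv (deriv f) ?x * (1 - ?x\<^sup>2)"
    unfolding sum.distrib sum_subtractf sum_distrib_left[symmetric] sum_inner
    by (simp add: inner_diff_left power2_eq_square)
  finally show ?thesis by (simp add: algebra_simps)
qed

section \<open>Rings with a derivation\<close>

text \<open>Abstracting to a commutative ring turns the long differential identities into ring
  computations without differentiability side conditions.\<close>

locale derivation =
  fixes d :: "'a::comm_ring_1 \<Rightarrow> 'a"
  assumes add: "d (a + b) = d a + d b"
    and mult: "d (a * b) = d a * b + a * d b"
begin

lemma zero [simp]: "d 0 = 0"
  using add[of 0 0] by simp

lemma one [simp]: "d 1 = 0"
  using mult[of 1 1] by simp

lemma minus: "d (- a) = - d a"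
  using add[of a "- a"] by (simp add: eq_neg_iff_add_eq_0 add.commute)

lemma diff: "d (a - b) = d a - d b"
  using add[of a "- b"] by (simp add: minus)

lemma of_nat [simp]: "d (of_nat k) = 0"
  by (induction k) (simp_all add: add)

lemma numeral [simp]: "d (numeral k) = 0"
  using of_nat[of "numeral k"] by simp

lemma power: "d (a ^ Suc k) = of_nat (Suc k) * a ^ k * d a"
  by (induction k) (simp_all add: mult algebra_simps)

lemma power_sign [simp]: "d ((- 1) ^ k) = 0"
  by (induction k) (simp_all add: mult minus)

lemma funpow_add: "(d ^^ k) (a + b) = (d ^^ k) a + (d ^^ k) b"
  by (induction k) (simp_all add: add)

lemma funpow_zero: "(d ^^ k) 0 = 0"
  by (induction k) simp_all

lemma funpow_sum: "(d ^^ k) (\<Sum>i\<in>A. g i) = (\<Sum>i\<in>A. (d ^^ k) (g i))"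
  by (induction A rule: infinite_finite_induct) (simp_all add: funpow_add funpow_zero)

lemma funpow_const_mult: "d c = 0 \<Longrightarrow> (d ^^ k) (c * a) = c * (d ^^ k) a"
  by (induction k) (simp_all add: mult)

text \<open>Integration by parts \<open>k\<close> times, stated as a total derivative: consecutive
  terms of the alternating sum telescope when differentiated.\<close>

lemma green:
  "(\<Sum>i<k. (- 1) ^ i * (d ^^ i) a * (d ^^ (k - 1 - i)) b) = s \<Longrightarrow>
   d s = a * (d ^^ k) b - (- 1) ^ k * (d ^^ k) a * b"
proof (induction k arbitrary: b s)
  case (Suc k)
  \<comment> \<open>All terms but the last carry a derivative on \<open>b\<close>; moving one of
    them into \<open>d b\<close> gives the sum of length \<open>k\<close>.\<close>
  define s' where "s' = (\<Sum>i<k. (- 1) ^ i * (d ^^ i) a * (d ^^ (k - 1 - i)) (d b))"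
  have shift: "(d ^^ (k - i)) b = (d ^^ (k - Suc i)) (d b)" if "i < k" for i
  proof -
    have "k - i = Suc (k - Suc i)" using that by simp
    then show ?thesis by (simp only: funpow_Suc_right o_apply)
  qed
  have "s = s' + (- 1) ^ k * (d ^^ k) a * b"
    unfolding Suc.prems[symmetric] s'_def
    by (simp add: shift)
  moreover have "d s' = a * (d ^^ k) (d b) - (- 1) ^ k * (d ^^ k) a * d b"
    by (rule Suc.IH[OF s'_def[symmetric]])
  ultimately show ?case
    by (simp add: add mult algebra_simps funpow_swap1)
qed simp

end

locale coordinate_derivation = derivation d for d :: "'a::comm_ring_1 \<Rightarrow> 'a" +
  fixes x :: 'a
  assumes d_x: "d x = 1"
begin

text \<open>The Leibniz rule stops after two terms because the second derivative of \<open>x\<close>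
  vanishes. At \<open>k = 0\<close> the truncated index is harmless, as its coefficient is
  zero.\<close>

lemma funpow_x_mult: "(d ^^ k) (x * a) = x * (d ^^ k) a + of_nat k * (d ^^ (k - 1)) a"
proof (induction k)
  case (Suc k)
  then show ?case by (cases k) (simp_all add: add mult d_x algebra_simps)
qed simp

lemma funpow_x_power_less: "j < k \<Longrightarrow> (d ^^ k) (x ^ j) = 0"
proof (induction j arbitrary: k)
  case 0
  then obtain l where "k = Suc l" by (cases k) auto
  then show ?case by (simp add: funpow_Suc_right funpow_zero del: funpow.simps)
next
  case (Suc j)
  then show ?case by (simp add: funpow_x_mult)
qed

lemma funpow_x_power: "(d ^^ k) (x ^ k) = of_nat (fact k)"
proof (induction k)
  case (Suc k)
  have "(d ^^ Suc k) (x ^ Suc k) = of_nat (Suc k) * (d ^^ k) (x ^ k)"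
    unfolding power_Suc by (subst funpow_x_mult) (simp add: funpow_x_power_less del: funpow.simps)
  then show ?case using Suc by (simp add: algebra_simps del: funpow.simps power_Suc)
qed simp

abbreviation p :: 'a where "p \<equiv> 1 - x\<^sup>2"

lemma d_p: "d p = - 2 * x"
  by (simp add: diff power2_eq_square mult d_x)

text \<open>The extra factor \<open>p\<close> avoids the exponent \<open>k - 1\<close>, so that
  \<open>k = 0\<close> is included.\<close>

lemma d_p_power: "p * d (p ^ k) = - 2 * of_nat k * x * p ^ k"
  by (cases k) (simp_all only: power d_p, simp_all add: algebra_simps)

lemma funpow_x_power_Suc: "(d ^^ k) (x ^ Suc k) = of_nat (fact (Suc k)) * x"
proof (induction k)
  case (Suc k)
  have "(d ^^ Suc k) (x ^ Suc (Suc k)) = x * (d ^^ Suc k) (x ^ Suc k) + of_nat (Suc k) * (d ^^ k) (x ^ Suc k)"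
    by (subst power_Suc, subst funpow_x_mult) simp
  also have "\<dots> = x * of_nat (fact (Suc k)) + of_nat (Suc k) * (of_nat (fact (Suc k)) * x)"
    by (simp only: Suc funpow_x_power)
  also have "\<dots> = of_nat (fact (Suc (Suc k))) * x"
    by (simp add: algebra_simps)
  finally show ?case .
qed simp

text \<open>After binomial expansion only the top term, of degree 2m + 1, survives 2m derivatives.
  This constant is what later cancels the linear term of the equation.\<close>

lemma funpow_x_p_power:
  "(d ^^ (2 * m)) (x * p ^ m) = (- 1) ^ m * of_nat (fact (2 * m + 1)) * x"
proof -
  let ?g = "\<lambda>i. (- 1) ^ i * of_nat (m choose i) * x ^ Suc (2 * i)"
  have const: "d ((- 1) ^ i * of_nat (m choose i)) = 0" for i
    by (simp add: mult)
  have "p ^ m = (- x\<^sup>2 + 1) ^ m" by simp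
  also have "\<dots> = (\<Sum>i\<le>m. of_nat (m choose i) * (- x\<^sup>2) ^ i)"
    by (subst binomial_ring) simp
  finally have "x * p ^ m = (\<Sum>i\<le>m. x * (of_nat (m choose i) * (- x\<^sup>2) ^ i))"
    by (simp add: sum_distrib_left)
  also have "\<dots> = (\<Sum>i\<le>m. ?g i)"
    by (intro sum.cong refl) (simp add: power_minus[of "x\<^sup>2"] power_mult[symmetric] algebra_simps)
  finally have "(d ^^ (2 * m)) (x * p ^ m) = (\<Sum>i\<le>m. (- 1) ^ i * of_nat (m choose i) * (d ^^ (2 * m)) (x ^ Suc (2 * i)))"
    by (simp only: funpow_sum funpow_const_mult[OF const])
  also have "\<dots> = (\<Sum>i\<in>{m}. (- 1) ^ i * of_nat (m choose i) * (d ^^ (2 * m)) (x ^ Suc (2 * i)))"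
    by (intro sum.mono_neutral_right) (auto simp: funpow_x_power_less simp del: power_Suc)
  also have "\<dots> = (- 1) ^ m * of_nat (fact (2 * m + 1)) * x"
    by (simp add: funpow_x_power_Suc del: power_Suc fact_Suc)
  finally show ?thesis .
qed

section \<open>The GJMS factors as ordinary differential operators\<close>

text \<open>For \<open>c\<close> the dimension of the sphere this is its Laplacian in the height
  coordinate. \<open>c\<close> is a ring element because a later step uses the value 2 - 2m, which
  may be negative.\<close>

definition zonal_laplacian :: "'a \<Rightarrow> 'a \<Rightarrow> 'a" where
  "zonal_laplacian c a = p * d (d a) - c * x * d a"

definition zonal_factor :: "nat \<Rightarrow> nat \<Rightarrow> 'a \<Rightarrow> 'a" where
  "zonal_factor n j a = - zonal_laplacian (of_nat n) a + of_nat j * (of_nat n - 1 - of_nat j) * a"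

lemma d_zonal_laplacian:
  "d c = 0 \<Longrightarrow> d (zonal_laplacian c a) = zonal_laplacian (c + 2) (d a) - c * d a"
  unfolding zonal_laplacian_def diff mult power2_eq_square d_x by (simp add: algebra_simps)

text \<open>Raising the dimension by two shifts the GJMS factors by one; this drives the induction that
  identifies their product.\<close>

lemma d_zonal_factor: "d (zonal_factor n j a) = zonal_factor (n + 2) (j + 1) (d a)"
proof -
  have "of_nat (n + 2) = of_nat n + (2::'a)" by simp
  then show ?thesis
    unfolding zonal_factor_def add minus d_zonal_laplacian[OF of_nat]
    by (simp only: mult diff of_nat one) (simp add: algebra_simps)
qed

lemma d_foldr_zonal_factor:
  "d (foldr (zonal_factor n) js a) = foldr (zonal_factor (n + 2)) (map Suc js) (d a)"
  by (induction js) (simp_all add: d_zonal_factor)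

text \<open>Each derivative raises the dimension by two and produces a zeroth-order term; the terms
  c, c + 2, ..., c + 2k - 2 add up to k (c + k - 1).\<close>

lemma zonal_laplacian_funpow:
  assumes "d c = 0"
  shows "zonal_laplacian (c + 2 * of_nat k) ((d ^^ k) a)
    = (d ^^ k) (zonal_laplacian c a + of_nat k * (c + of_nat k - 1) * a)"
proof (induction k)
  case (Suc k)
  let ?c = "c + 2 * of_nat k"
  have c: "d ?c = 0" using assms by (simp add: add mult)
  have const: "d (of_nat j * (c + of_nat j - 1)) = 0" for j
    using assms by (simp add: add mult diff)
  have split: "(d ^^ j) (zonal_laplacian c a + of_nat i * (c + of_nat i - 1) * a)
      = (d ^^ j) (zonal_laplacian c a) + of_nat i * (c + of_nat i - 1) * (d ^^ j) a" for i j
    unfolding funpow_add funpow_const_mult[OF const] ..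
  have "zonal_laplacian (c + 2 * of_nat (Suc k)) ((d ^^ Suc k) a)
      = d (zonal_laplacian ?c ((d ^^ k) a)) + ?c * d ((d ^^ k) a)"
    unfolding d_zonal_laplacian[OF c] by (simp add: algebra_simps)
  also have "\<dots> = (d ^^ Suc k) (zonal_laplacian c a)
      + (of_nat k * (c + of_nat k - 1) + ?c) * (d ^^ Suc k) a"
    unfolding Suc split add mult[of _ "(d ^^ k) a"] const by (simp add: algebra_simps)
  also have "of_nat k * (c + of_nat k - 1) + ?c = of_nat (Suc k) * (c + of_nat (Suc k) - 1)"
    by (simp add: algebra_simps)
  finally show ?case unfolding split .
qed simp

lemma p_power_Suc_d: "p ^ Suc m * d a = p * d (p ^ m * a) + 2 * of_nat m * x * (p ^ m * a)"
proof -
  have "p * d (p ^ m * a) = (p * d (p ^ m)) * a + p ^ Suc m * d a"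
    by (simp add: mult algebra_simps)
  then show ?thesis unfolding d_p_power by (simp add: algebra_simps)
qed

text \<open>Pulling the operator through 2m derivatives lowers the dimension parameter to 2 - 2m.
  There, acting on w = p^m a, operator and zeroth-order term combine into the exact derivative of p
  w' + 2 m x w, which is p^(m+1) a'.\<close>

lemma zonal_laplacian_rodrigues:
  "zonal_laplacian (of_nat (2 * m + 2)) ((d ^^ (2 * m)) (p ^ m * a)) = (d ^^ (2 * m + 1)) (p ^ Suc m * d a)"
proof -
  let ?c = "2 - 2 * of_nat m :: 'a" and ?w = "p ^ m * a"
  have c: "d ?c = 0" by (simp add: diff mult)
  have "of_nat (2 * m + 2) = ?c + 2 * of_nat (2 * m)" by simp
  then have "zonal_laplacian (of_nat (2 * m + 2)) ((d ^^ (2 * m)) ?w)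
      = (d ^^ (2 * m)) (zonal_laplacian ?c ?w + of_nat (2 * m) * (?c + of_nat (2 * m) - 1) * ?w)"
    by (simp only: zonal_laplacian_funpow[OF c])
  also have "zonal_laplacian ?c ?w + of_nat (2 * m) * (?c + of_nat (2 * m) - 1) * ?w = d (p ^ Suc m * d a)"
    unfolding p_power_Suc_d zonal_laplacian_def add mult[of _ ?w] mult[of p] d_p
    by (simp add: mult d_x algebra_simps)
  finally show ?thesis by (simp add: funpow_swap1)
qed

text \<open>The two formulas are proved in alternation. The factor \<open>j = 0\<close>, a pure
  Laplacian, leads from the first to the second by the Rodrigues identity; differentiating the
  second raises the dimension by two, shifts all factors and gives the first for
  \<open>Suc m\<close>.\<close>

lemma foldr_zonal_factor_rodrigues_aux:
  assumes "surj d"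
  shows "foldr (zonal_factor (2 * m + 2)) (map Suc [0..<m]) a = (- 1) ^ m * (d ^^ (2 * m)) (p ^ m * a)"
    and "foldr (zonal_factor (2 * m + 2)) [0..<Suc m] a = (- 1) ^ Suc m * (d ^^ (2 * m + 1)) (p ^ Suc m * d a)"
proof -
  have step: "foldr (zonal_factor (2 * m + 2)) [0..<Suc m] a = (- 1) ^ Suc m * (d ^^ (2 * m + 1)) (p ^ Suc m * d a)"
    if "foldr (zonal_factor (2 * m + 2)) (map Suc [0..<m]) a = (- 1) ^ m * (d ^^ (2 * m)) (p ^ m * a)" for m a
  proof -
    have scale: "zonal_laplacian c ((- 1) ^ m * b) = (- 1) ^ m * zonal_laplacian c b" for c b
      by (simp add: zonal_laplacian_def mult algebra_simps)
    \<comment> \<open>\<open>foldr\<close> applies the head of the list last, so the factor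
      \<open>j = 0\<close> is the outermost.\<close>
    have "[0..<Suc m] = 0 # map Suc [0..<m]"
      by (simp add: map_Suc_upt upt_conv_Cons del: upt_Suc)
    then have "foldr (zonal_factor (2 * m + 2)) [0..<Suc m] a
        = zonal_factor (2 * m + 2) 0 ((- 1) ^ m * (d ^^ (2 * m)) (p ^ m * a))"
      by (simp only: that foldr.simps o_apply)
    also have "\<dots> = (- 1) ^ Suc m * zonal_laplacian (of_nat (2 * m + 2)) ((d ^^ (2 * m)) (p ^ m * a))"
      by (simp add: zonal_factor_def scale)
    finally show ?thesis unfolding zonal_laplacian_rodrigues .
  qed
  show *: "foldr (zonal_factor (2 * m + 2)) (map Suc [0..<m]) a = (- 1) ^ m * (d ^^ (2 * m)) (p ^ m * a)" for a
  proof (induction m arbitrary: a)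
    case (Suc m)
    \<comment> \<open>The second formula is differentiated at an antiderivative of \<open>a\<close>;
      surjectivity of \<open>d\<close> supplies it.\<close>
    obtain b where b: "a = d b" using assms by (metis surjD)
    have "foldr (zonal_factor (2 * Suc m + 2)) (map Suc [0..<Suc m]) a
        = d (foldr (zonal_factor (2 * m + 2)) [0..<Suc m] b)"
      unfolding b d_foldr_zonal_factor by simp
    also have "\<dots> = (- 1) ^ Suc m * (d ^^ (2 * Suc m)) (p ^ Suc m * a)"
      unfolding step[OF Suc.IH] b by (simp add: mult minus)
    finally show ?case .
  qed simp
  show "foldr (zonal_factor (2 * m + 2)) [0..<Suc m] a = (- 1) ^ Suc m * (d ^^ (2 * m + 1)) (p ^ Suc m * d a)"
    by (rule step[OF *])
qed

lemma foldr_zonal_factor_rodrigues: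
  assumes "surj d" "0 < m"
  shows "foldr (zonal_factor (2 * m)) [0..<m] a = (- 1) ^ m * (d ^^ (2 * m - 1)) (p ^ m * d a)"
  using foldr_zonal_factor_rodrigues_aux(2)[OF assms(1), of "m - 1"] assms(2)
  by (simp add: Suc_diff_Suc numeral_2_eq_2)

section \<open>The integral identity\<close>

text \<open>Each sum is the boundary term of a repeated integration by parts (see \<open>green\<close>).\<close>

definition flux :: "nat \<Rightarrow> 'a \<Rightarrow> 'a" where
  "flux l w =
     2 * (\<Sum>i<2 * Suc l. (- 1) ^ i * (d ^^ i) (x * p ^ Suc l) * (d ^^ (2 * Suc l - 1 - i)) w)
     - 2 * of_nat (2 * Suc l) * (\<Sum>i<l. (- 1) ^ i * (d ^^ i) (x * w) * (d ^^ (l - 1 - i)) ((d ^^ Suc l) w))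
     - of_nat (2 * Suc l) * (- 1) ^ l * (2 * (d ^^ l) (x * w) * (d ^^ l) w - x * ((d ^^ l) w)\<^sup>2)"

text \<open>By the equation the first sum differentiates to N x w D^(2m-1) w, the linear terms
  cancelling. The second sum moves half of the derivatives over, and the last term absorbs what is
  left except a multiple of V^2. The overall factor 2 keeps 1/2 out of the ring.\<close>

lemma d_flux:
  fixes l :: nat and w :: 'a
  defines "m \<equiv> Suc l"
  assumes eq: "p ^ m * (d ^^ (2 * m)) w
    = of_nat (2 * m) * w * (d ^^ (2 * m - 1)) w + (- 1) ^ m * of_nat (fact (2 * m + 1)) * w"
  shows "d (flux l w) = - ((- 1) ^ l * of_nat (2 * m * (2 * l + 1)) * ((d ^^ l) w)\<^sup>2)"
proof -
  define B1 where "B1 = (\<Sum>i<2 * m. (- 1) ^ i * (d ^^ i) (x * p ^ m) * (d ^^ (2 * m - 1 - i)) w)"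
  define B2 where "B2 = (\<Sum>i<l. (- 1) ^ i * (d ^^ i) (x * w) * (d ^^ (l - 1 - i)) ((d ^^ m) w))"
  define V Z N S where "V = (d ^^ l) w" and "Z = (d ^^ l) (x * w)"
    and "N = (of_nat (2 * m) :: 'a)" and "S = (- 1 :: 'a) ^ l"
  have "d B1 = x * p ^ m * (d ^^ (2 * m)) w - (- 1) ^ (2 * m) * (d ^^ (2 * m)) (x * p ^ m) * w"
    by (rule green[OF B1_def[symmetric]])
  also have "x * p ^ m * (d ^^ (2 * m)) w = x * (p ^ m * (d ^^ (2 * m)) w)"
    by (simp add: mult.assoc)
  finally have B1: "d B1 = N * x * w * (d ^^ (2 * m - 1)) w"
    unfolding eq funpow_x_p_power N_def by (simp add: algebra_simps)
  have "(d ^^ l) ((d ^^ m) w) = (d ^^ (2 * m - 1)) w"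
    unfolding m_def by (simp add: funpow_add[symmetric] mult_2 flip: funpow.simps comp_apply[of "d ^^ l"] Nat.funpow_add)
  then have B2: "d B2 = x * w * (d ^^ (2 * m - 1)) w - S * Z * d V"
    using green[OF B2_def[symmetric]] by (simp add: S_def Z_def V_def m_def)
  have dN: "d N = 0" "d S = 0" by (simp_all only: N_def S_def of_nat power_sign)
  \<comment> \<open>The coefficient m instead of l arises because \<open>d Z\<close> is the
    derivative of \<open>x * w\<close> of order l + 1. It is the source of the factor 2m - 1
    below.\<close>
  have dZ: "d Z = x * d V + of_nat m * V"
    using funpow_x_mult[of m w] by (simp add: Z_def V_def m_def)
  have flux: "flux l w = 2 * B1 - 2 * N * B2 - N * S * (2 * Z * V - x * V\<^sup>2)"
    by (simp only: flux_def B1_def B2_def V_def Z_def N_def S_def m_def)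
  then have "d (flux l w) = 2 * d B1 - 2 * N * d B2
      - N * S * (2 * (d Z * V + Z * d V) - V\<^sup>2 - 2 * x * V * d V)"
    unfolding flux diff mult power2_eq_square dN d_x by (simp add: algebra_simps)
  also have "\<dots> = - (S * (N * (2 * of_nat m - 1)) * V\<^sup>2)"
    unfolding B1 B2 dZ by (simp add: power2_eq_square algebra_simps)
  also have "N * (2 * of_nat m - 1) = of_nat (2 * m * (2 * l + 1))"
    by (simp add: N_def m_def algebra_simps)
  finally show ?thesis unfolding S_def V_def .
qed

end

section \<open>The differential ring of smooth functions on the open interval\<close>

text \<open>The value \<open>0\<close> outside the interval makes equality in the ring coincide with equality on the interval.\<close>

typedef smooth_fun = "{f. smooth {-1<..<1} f \<and> (\<forall>x. x \<notin> {-1<..<1} \<longrightarrow> f x = 0)}"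
  morphisms ev Abs_smooth_fun
  by (rule exI[of _ "\<lambda>_. 0"]) (simp add: smooth_const)

definition restrict_smooth :: "(real \<Rightarrow> real) \<Rightarrow> smooth_fun" where
  "restrict_smooth f = Abs_smooth_fun (\<lambda>x. if x \<in> {-1<..<1} then f x else 0)"

lemma smooth_ev: "smooth {-1<..<1} (ev a)"
  using ev[of a] by simp

lemma ev_outside: "x \<notin> {-1<..<1} \<Longrightarrow> ev a x = 0"
  using ev[of a] by blast

lemma ev_restrict_smooth:
  assumes "smooth {-1<..<1} f"
  shows "ev (restrict_smooth f) x = (if x \<in> {-1<..<1} then f x else 0)"
proof -
  have "smooth {-1<..<1} (\<lambda>x. if x \<in> {-1<..<1} then f x else 0)"
    by (rule smooth_cong[OF _ _ assms]) auto
  then show ?thesis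
    unfolding restrict_smooth_def by (subst Abs_smooth_fun_inverse) auto
qed

lemma smooth_fun_eqI: "(\<And>x. x \<in> {-1<..<1} \<Longrightarrow> ev a x = ev b x) \<Longrightarrow> a = b"
  by (metis ev_inject ev_outside ext)

instantiation smooth_fun :: comm_ring_1
begin

definition "0 = restrict_smooth (\<lambda>_. 0)"
definition "1 = restrict_smooth (\<lambda>_. 1)"
definition "a + b = restrict_smooth (\<lambda>x. ev a x + ev b x)"
definition "a - b = restrict_smooth (\<lambda>x. ev a x - ev b x)"
definition "- a = restrict_smooth (\<lambda>x. - ev a x)"
definition "a * b = restrict_smooth (\<lambda>x. ev a x * ev b x)"

lemma ev_zero [simp]: "ev 0 x = 0"
  unfolding zero_smooth_fun_def by (subst ev_restrict_smooth) (simp_all add: smooth_const)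

lemma ev_one: "ev 1 x = (if x \<in> {-1<..<1} then 1 else 0)"
  unfolding one_smooth_fun_def by (subst ev_restrict_smooth) (simp_all add: smooth_const)

lemma ev_add: "ev (a + b) x = ev a x + ev b x"
  unfolding plus_smooth_fun_def
  by (subst ev_restrict_smooth) (simp_all add: smooth_add smooth_ev ev_outside)

lemma ev_diff: "ev (a - b) x = ev a x - ev b x"
  unfolding minus_smooth_fun_def
  by (subst ev_restrict_smooth) (simp_all add: smooth_diff smooth_ev ev_outside)

lemma ev_minus: "ev (- a) x = - ev a x"
  unfolding uminus_smooth_fun_def
  by (subst ev_restrict_smooth) (simp_all add: smooth_minus smooth_ev ev_outside)

lemma ev_mult: "ev (a * b) x = ev a x * ev b x"
  unfolding times_smooth_fun_def
  by (subst ev_restrict_smooth) (simp_all add: smooth_mult smooth_ev ev_outside)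

instance
proof
  have "ev 0 0 \<noteq> ev 1 0" by (simp add: ev_one)
  then show "(0::smooth_fun) \<noteq> 1" by metis
qed (rule smooth_fun_eqI, simp add: ev_add ev_diff ev_minus ev_mult ev_one algebra_simps)+

end

lemma ev_power: "x \<in> {-1<..<1} \<Longrightarrow> ev (a ^ k) x = ev a x ^ k"
  by (induction k) (simp_all add: ev_one ev_mult)

text \<open>Restricted to the interval because the ring's \<open>1\<close> takes the value 0 outside
  it.\<close>

lemma ev_of_nat: "x \<in> {-1<..<1} \<Longrightarrow> ev (of_nat k) x = real k"
  by (induction k) (simp_all add: ev_one ev_add)

lemma ev_numeral: "x \<in> {-1<..<1} \<Longrightarrow> ev (numeral k) x = numeral k"
  using ev_of_nat[of x "numeral k"] by simp

lemmas ev_simps = ev_one ev_add ev_diff ev_minus ev_mult ev_power ev_of_nat ev_numeral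

section \<open>Differentiation and antiderivatives in the ring\<close>

definition der :: "smooth_fun \<Rightarrow> smooth_fun" where
  "der a = restrict_smooth (deriv (ev a))"

definition coord :: smooth_fun where
  "coord = restrict_smooth (\<lambda>x. x)"

lemma ev_coord: "x \<in> {-1<..<1} \<Longrightarrow> ev coord x = x"
  unfolding coord_def by (subst ev_restrict_smooth) (simp_all add: smooth_ident)

lemma ev_der: "x \<in> {-1<..<1} \<Longrightarrow> ev (der a) x = deriv (ev a) x"
  unfolding der_def by (subst ev_restrict_smooth) (simp_all add: smooth_deriv smooth_ev)

lemma ev_has_deriv: "x \<in> {-1<..<1} \<Longrightarrow> (ev a has_real_derivative ev (der a) x) (at x)"
  by (simp only: ev_der smooth_has_deriv[OF smooth_ev])

lemma der_eqI:
  assumes "\<And>x. x \<in> {-1<..<1} \<Longrightarrow> (ev a has_real_derivative ev b x) (at x)"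
  shows "der a = b"
  by (rule smooth_fun_eqI) (rule DERIV_unique[OF ev_has_deriv assms])

lemma ev_der_der: "x \<in> {-1<..<1} \<Longrightarrow> ev (der (der a)) x = deriv (deriv (ev a)) x"
  by (simp only: ev_der[of x "der a"] deriv_cong_open[OF open_greaterThanLessThan ev_der])

interpretation sf: coordinate_derivation der coord
proof
  fix a b
  show "der (a + b) = der a + der b"
  proof (rule der_eqI)
    fix x :: real assume x: "x \<in> {-1<..<1}"
    have "ev (a + b) = (\<lambda>x. ev a x + ev b x)" by (simp add: ev_add fun_eq_iff)
    with DERIV_add[OF ev_has_deriv[OF x] ev_has_deriv[OF x]]
    show "(ev (a + b) has_real_derivative ev (der a + der b) x) (at x)" by (simp add: ev_add)
  qed
  show "der (a * b) = der a * b + a * der b"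
  proof (rule der_eqI)
    fix x :: real assume x: "x \<in> {-1<..<1}"
    have "ev (a * b) = (\<lambda>x. ev a x * ev b x)" by (simp add: ev_mult fun_eq_iff)
    with DERIV_mult[OF ev_has_deriv[OF x] ev_has_deriv[OF x], of a b]
    show "(ev (a * b) has_real_derivative ev (der a * b + a * der b) x) (at x)"
      by (simp add: ev_mult ev_add mult.commute)
  qed
  show "der coord = 1"
  proof (rule der_eqI)
    fix x :: real assume x: "x \<in> {-1<..<1}"
    have "(ev coord has_real_derivative 1) (at x)"
      by (rule has_field_derivative_transform_within_open[OF DERIV_ident open_greaterThanLessThan x])
        (simp add: ev_coord)
    with x show "(ev coord has_real_derivative ev 1 x) (at x)" by (simp add: ev_one)
  qed
qed

text \<open>A smooth function on the open interval has an antiderivative there, which is again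
  smooth; it may be unbounded at the ends. The Rodrigues induction relies on this.\<close>

lemma surj_der: "surj der"
proof (rule surjI)
  fix b
  have "\<exists>F. \<forall>x::real. ereal (-1) < x \<longrightarrow> x < ereal 1 \<longrightarrow> (F has_vector_derivative ev b x) (at x)"
    by (rule einterval_antiderivative) (auto intro!: DERIV_isCont[OF ev_has_deriv])
  then obtain F where F: "(F has_real_derivative ev b x) (at x)" if "x \<in> {-1<..<1}" for x
    by (auto simp: has_real_derivative_iff_has_vector_derivative)
  then have "smooth {-1<..<1} F"
    by (rule smooth_antideriv[OF open_greaterThanLessThan _ smooth_ev])
  then have ev_F: "F x = ev (restrict_smooth F) x" if "x \<in> {-1<..<1}" for x
    using that by (simp add: ev_restrict_smooth)
  have "der (restrict_smooth F) = b"
    by (rule der_eqI, rule has_field_derivative_transform_within_open[OF F open_greaterThanLessThan _ ev_F])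
  then have "\<exists>a. der a = b" ..
  then show "der (SOME a. der a = b) = b" by (rule someI_ex)
qed

section \<open>Boundary behaviour\<close>

text \<open>Nothing is assumed about the derivatives of a smooth function of \<open>x\<close> at \<open>x = \<plusminus>1\<close>; all that is
  used is that, with \<open>x = cos \<theta>\<close>, it is smooth in \<open>\<theta>\<close> up to the ends, and \<open>D = -(sin \<theta>)\<^sup>-\<^sup>1 d/d\<theta>\<close>
  lowers the power of \<open>sin \<theta>\<close> by two.\<close>

definition boundary_order :: "int \<Rightarrow> smooth_fun \<Rightarrow> bool" where
  "boundary_order k a \<longleftrightarrow>
     (\<exists>q. smooth UNIV q \<and> (\<forall>\<theta>\<in>{0<..<pi}. ev a (cos \<theta>) = sin \<theta> powi k * q \<theta>))"

lemma cos_in_interval: "\<theta> \<in> {0<..<pi} \<Longrightarrow> cos \<theta> \<in> {-1<..<1}"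
  using cos_monotone_0_pi[of 0 \<theta>] cos_monotone_0_pi[of \<theta> pi] by simp

lemma sin_pos: "\<theta> \<in> {0<..<pi} \<Longrightarrow> 0 < sin \<theta>"
  by (simp add: sin_gt_zero)

lemma boundary_orderI:
  assumes "smooth UNIV q" "\<And>\<theta>. \<theta> \<in> {0<..<pi} \<Longrightarrow> ev a (cos \<theta>) = sin \<theta> powi k * q \<theta>"
  shows "boundary_order k a"
  using assms unfolding boundary_order_def by blast

lemma boundary_orderE:
  assumes "boundary_order k a"
  obtains q where "smooth UNIV q" "\<And>\<theta>. \<theta> \<in> {0<..<pi} \<Longrightarrow> ev a (cos \<theta>) = sin \<theta> powi k * q \<theta>"
  using assms unfolding boundary_order_def by blast

section \<open>Calculus of boundary orders\<close>

lemma boundary_order_of_nat: "boundary_order 0 (of_nat k)"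
  by (rule boundary_orderI[OF smooth_const]) (simp_all only: open_UNIV ev_of_nat cos_in_interval, simp)

lemma boundary_order_coord: "boundary_order 0 coord"
  by (rule boundary_orderI[OF smooth_cos]) (simp only: ev_coord cos_in_interval, simp)

lemma boundary_order_add:
  assumes "boundary_order k a" "boundary_order k b"
  shows "boundary_order k (a + b)"
proof -
  from assms(1) obtain q where "smooth UNIV q"
    and "\<And>\<theta>. \<theta> \<in> {0<..<pi} \<Longrightarrow> ev a (cos \<theta>) = sin \<theta> powi k * q \<theta>"
    by (rule boundary_orderE) blast
  moreover from assms(2) obtain r where "smooth UNIV r"
    and "\<And>\<theta>. \<theta> \<in> {0<..<pi} \<Longrightarrow> ev b (cos \<theta>) = sin \<theta> powi k * r \<theta>"
    by (rule boundary_orderE) blast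
  ultimately show ?thesis
    by (intro boundary_orderI[OF smooth_add[of UNIV q r]]) (simp_all add: ev_add distrib_left)
qed

lemma boundary_order_mult:
  assumes "boundary_order k a" "boundary_order l b"
  shows "boundary_order (k + l) (a * b)"
proof -
  from assms(1) obtain q where q: "smooth UNIV q"
    "\<And>\<theta>. \<theta> \<in> {0<..<pi} \<Longrightarrow> ev a (cos \<theta>) = sin \<theta> powi k * q \<theta>"
    by (rule boundary_orderE) blast
  from assms(2) obtain r where r: "smooth UNIV r"
    "\<And>\<theta>. \<theta> \<in> {0<..<pi} \<Longrightarrow> ev b (cos \<theta>) = sin \<theta> powi l * r \<theta>"
    by (rule boundary_orderE) blast
  show ?thesis
  proof (rule boundary_orderI[OF smooth_mult[OF open_UNIV q(1) r(1)]])
    fix \<theta> :: real assume \<theta>: "\<theta> \<in> {0<..<pi}"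
    then have "sin \<theta> powi (k + l) = sin \<theta> powi k * sin \<theta> powi l"
      using sin_pos[OF \<theta>] by (simp add: power_int_add)
    with q r \<theta> show "ev (a * b) (cos \<theta>) = sin \<theta> powi (k + l) * (q \<theta> * r \<theta>)"
      by (simp add: ev_mult)
  qed
qed

lemma boundary_order_mono:
  assumes "boundary_order k a" "l \<le> k"
  shows "boundary_order l a"
proof -
  obtain q where q: "smooth UNIV q"
    and eq: "\<And>\<theta>. \<theta> \<in> {0<..<pi} \<Longrightarrow> ev a (cos \<theta>) = sin \<theta> powi k * q \<theta>"
    using boundary_orderE[OF assms(1)] by blast
  have pow: "smooth UNIV (\<lambda>\<theta>. sin \<theta> ^ j)" for j
    by (induction j) (simp_all add: smooth_const smooth_mult smooth_sin)
  show ?thesis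
  proof (rule boundary_orderI[OF smooth_mult[OF open_UNIV pow[of "nat (k - l)"] q]])
    fix \<theta> :: real assume \<theta>: "\<theta> \<in> {0<..<pi}"
    have "sin \<theta> powi (l + (k - l)) = sin \<theta> powi l * sin \<theta> powi (k - l)"
      using sin_pos[OF \<theta>] by (intro power_int_add) simp
    also have "sin \<theta> powi (k - l) = sin \<theta> ^ nat (k - l)"
      using assms(2) by (simp add: power_int_def)
    finally show "ev a (cos \<theta>) = sin \<theta> powi l * (sin \<theta> ^ nat (k - l) * q \<theta>)"
      using eq[OF \<theta>] by simp
  qed
qed

lemma boundary_order_minus: "boundary_order k a \<Longrightarrow> boundary_order k (- a)"
  by (erule boundary_orderE, rule boundary_orderI[OF smooth_minus[OF open_UNIV]]) (simp_all only: ev_minus mult_minus_right)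

lemma boundary_order_diff: "boundary_order k a \<Longrightarrow> boundary_order k b \<Longrightarrow> boundary_order k (a - b)"
  using boundary_order_add[of k a "- b"] by (simp add: boundary_order_minus)

lemma boundary_order_sum: "(\<And>i. i \<in> A \<Longrightarrow> boundary_order k (g i)) \<Longrightarrow> boundary_order k (\<Sum>i\<in>A. g i)"
proof (induction A rule: infinite_finite_induct)
  case (insert i A)
  then show ?case by (simp add: boundary_order_add)
qed (auto intro: boundary_orderI[OF smooth_const[of UNIV 0]])

lemma boundary_order_power: "boundary_order k a \<Longrightarrow> boundary_order (int j * k) (a ^ j)"
proof (induction j)
  case 0
  then show ?case using boundary_order_of_nat[of 1] by simp
next
  case (Suc j)
  then show ?case using boundary_order_mult[of k a "int j * k" "a ^ j"] by (simp add: algebra_simps)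
qed

lemma boundary_order_sign: "boundary_order 0 ((- 1) ^ j)"
  using boundary_order_power[OF boundary_order_minus[OF boundary_order_of_nat[of 1]], of j] by simp

lemma boundary_order_p: "boundary_order 2 sf.p"
proof (rule boundary_orderI[OF smooth_const[OF open_UNIV, of 1]])
  fix \<theta> :: real assume \<theta>: "\<theta> \<in> {0<..<pi}"
  from cos_in_interval[OF this] have "ev sf.p (cos \<theta>) = 1 - (cos \<theta>)\<^sup>2"
    by (simp only: ev_simps ev_coord) simp
  then show "ev sf.p (cos \<theta>) = sin \<theta> powi 2 * 1"
    by (simp add: sin_squared_eq)
qed

lemma ev_cos_has_deriv:
  assumes "\<theta> \<in> {0<..<pi}"
  shows "((\<lambda>\<theta>. ev a (cos \<theta>)) has_real_derivative - sin \<theta> * ev (der a) (cos \<theta>)) (at \<theta>)"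
  using DERIV_chain2[OF ev_has_deriv[OF cos_in_interval[OF assms]] DERIV_cos] by (simp add: mult.commute)

lemma boundary_order_der:
  assumes "boundary_order k a"
  shows "boundary_order (k - 2) (der a)"
proof -
  obtain q where q: "smooth UNIV q"
    and eq: "\<And>\<theta>. \<theta> \<in> {0<..<pi} \<Longrightarrow> ev a (cos \<theta>) = sin \<theta> powi k * q \<theta>"
    using boundary_orderE[OF assms] by blast
  \<comment> \<open>Obtained by differentiating sin^k q in the angle and dividing by - sin, with
    sin^(k-2) split off.\<close>
  let ?r = "\<lambda>\<theta>. - (of_int k * (cos \<theta> * q \<theta>) + sin \<theta> * deriv q \<theta>)"
  have "smooth UNIV ?r"
    by (intro smooth_minus smooth_add smooth_mult smooth_const smooth_cos smooth_sin smooth_deriv q open_UNIV)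
  then show ?thesis
  proof (rule boundary_orderI)
    fix \<theta> :: real assume \<theta>: "\<theta> \<in> {0<..<pi}"
    let ?s = "sin \<theta>"
    have s: "?s > 0" using \<theta> by (rule sin_pos)
    have "((\<lambda>\<theta>. sin \<theta> powi k * q \<theta>) has_real_derivative
        of_int k * ?s powi (k - 1) * cos \<theta> * q \<theta> + deriv q \<theta> * ?s powi k) (at \<theta>)"
      using s by (intro DERIV_mult DERIV_power_int DERIV_sin smooth_has_deriv[OF q]) auto
    then have "((\<lambda>\<theta>. ev a (cos \<theta>)) has_real_derivative
        of_int k * ?s powi (k - 1) * cos \<theta> * q \<theta> + deriv q \<theta> * ?s powi k) (at \<theta>)"
      by (rule has_field_derivative_transform_within_open[OF _ open_greaterThanLessThan \<theta>]) (simp add: eq)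
    from DERIV_unique[OF this ev_cos_has_deriv[OF \<theta>]]
    have "?s * ev (der a) (cos \<theta>) = - (of_int k * ?s powi (k - 1) * cos \<theta> * q \<theta> + deriv q \<theta> * ?s powi k)"
      by simp
    also have "?s powi (k - 1) = ?s powi (k - 2) * ?s"
      using power_int_add[of ?s "k - 2" 1] s by simp
    also have "?s powi k = ?s powi (k - 2) * (?s * ?s)"
      using power_int_add[of ?s "k - 2" 2] s by (simp add: power2_eq_square)
    finally have "?s * ev (der a) (cos \<theta>) = ?s * (?s powi (k - 2) * ?r \<theta>)"
      by (simp add: algebra_simps)
    then show "ev (der a) (cos \<theta>) = ?s powi (k - 2) * ?r \<theta>"
      using s by simp
  qed
qed

lemma boundary_order_funpow_der: "boundary_order k a \<Longrightarrow> boundary_order (k - 2 * int j) ((der ^^ j) a)"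
proof (induction j)
  case (Suc j)
  then show ?case using boundary_order_der[of "k - 2 * int j" "(der ^^ j) a"] by (simp add: algebra_simps)
qed simp

text \<open>At order 0 the general loss of two improves to one: D a is - g' / sin. This sharper
  start gives p^m a' the order 2m - 1.\<close>

lemma boundary_order_der_even:
  assumes "smooth UNIV g" and "\<And>\<theta>. \<theta> \<in> {0<..<pi} \<Longrightarrow> ev a (cos \<theta>) = g \<theta>"
  shows "boundary_order (-1) (der a)"
proof (rule boundary_orderI[OF smooth_minus[OF open_UNIV smooth_deriv[OF assms(1)]]])
  fix \<theta> :: real assume \<theta>: "\<theta> \<in> {0<..<pi}"
  have "((\<lambda>\<theta>. ev a (cos \<theta>)) has_real_derivative deriv g \<theta>) (at \<theta>)"
    by (rule has_field_derivative_transform_within_open[OF smooth_has_deriv[OF assms(1)] open_greaterThanLessThan \<theta>])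
      (simp_all add: assms(2))
  from DERIV_unique[OF this ev_cos_has_deriv[OF \<theta>]] sin_pos[OF \<theta>]
  show "ev (der a) (cos \<theta>) = sin \<theta> powi (-1) * - deriv g \<theta>"
    by (simp add: power_int_minus field_simps)
qed

text \<open>Replaces integration over the interval: a monotone function with boundary value zero at
  both ends is squeezed to zero.\<close>

lemma monotone_vanishing_boundary:
  assumes "boundary_order 1 a" and mono: "\<And>x. x \<in> {-1<..<1} \<Longrightarrow> 0 \<le> ev (der a) x"
  shows "a = 0"
proof (rule smooth_fun_eqI)
  obtain q where q: "smooth UNIV q"
    and eq: "\<And>\<theta>. \<theta> \<in> {0<..<pi} \<Longrightarrow> ev a (cos \<theta>) = sin \<theta> * q \<theta>"
    using boundary_orderE[OF assms(1)] by auto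
  \<comment> \<open>Equals - a(cos) in the interior and is continuous at 0 and \<open>pi\<close>,
    where it vanishes. The sign compensates for \<open>cos\<close> being decreasing.\<close>
  let ?h = "\<lambda>\<theta>. - (sin \<theta> * q \<theta>)"
  have cont: "continuous_on S ?h" for S
    by (intro continuous_intros continuous_on_subset[OF smooth_continuous_on[OF q]]) simp
  have der: "(?h has_real_derivative sin \<theta> * ev (der a) (cos \<theta>)) (at \<theta>)" if \<theta>: "\<theta> \<in> {0<..<pi}" for \<theta>
  proof -
    have "((\<lambda>\<theta>. - ev a (cos \<theta>)) has_real_derivative sin \<theta> * ev (der a) (cos \<theta>)) (at \<theta>)"
      using DERIV_minus[OF ev_cos_has_deriv[OF \<theta>]] by simp
    then show ?thesis
      by (rule has_field_derivative_transform_within_open[OF _ open_greaterThanLessThan \<theta>]) (simp add: eq)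
  qed
  have pos: "0 \<le> sin \<theta> * ev (der a) (cos \<theta>)" if "\<theta> \<in> {0<..<pi}" for \<theta>
    using sin_pos[OF that] mono[OF cos_in_interval[OF that]] by simp
  have incr: "?h s \<le> ?h t" if "0 \<le> s" "s \<le> t" "t \<le> pi" for s t
  proof (rule DERIV_nonneg_imp_increasing_open[OF that(2) _ cont])
    fix \<theta> assume "s < \<theta>" "\<theta> < t"
    then have "\<theta> \<in> {0<..<pi}" using that by simp
    then show "\<exists>y. (?h has_real_derivative y) (at \<theta>) \<and> 0 \<le> y" using der pos by blast
  qed
  fix x :: real assume x: "x \<in> {-1<..<1}"
  define \<theta> where "\<theta> = arccos x"
  have \<theta>: "\<theta> \<in> {0<..<pi}" "cos \<theta> = x"
    using x arccos_lt_bounded[of x] by (auto simp: \<theta>_def)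
  have "?h \<theta> = 0" using incr[of 0 \<theta>] incr[of \<theta> pi] \<theta>(1) by simp
  then show "ev a x = ev 0 x" using eq[OF \<theta>(1)] \<theta>(2) by simp
qed

section \<open>Uniqueness\<close>

text \<open>A count of orders: each derivative costs two, so with m = l + 1 the terms of the first
  sum have order 2m + (2l + 1) - 2(2m - 1) = 1, and all remaining terms have order 2.\<close>

lemma boundary_order_flux:
  assumes w: "boundary_order (2 * int l + 1) w"
  shows "boundary_order 1 (sf.flux l w)"
proof -
  let ?m = "Suc l"
  have xp: "boundary_order (2 * int ?m) (coord * sf.p ^ ?m)"
    using boundary_order_mult[OF boundary_order_coord boundary_order_power[OF boundary_order_p, of ?m]]
    by (simp add: mult.commute)
  have xw: "boundary_order (2 * int l + 1) (coord * w)"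
    using boundary_order_mult[OF boundary_order_coord w] by simp
  have V: "boundary_order 1 ((der ^^ l) w)"
    using boundary_order_funpow_der[OF w, of l] by simp
  have Z: "boundary_order 1 ((der ^^ l) (coord * w))"
    using boundary_order_funpow_der[OF xw, of l] by simp
  have W: "boundary_order (-1) ((der ^^ ?m) w)"
    using boundary_order_funpow_der[OF w, of ?m] by simp
  have scale: "boundary_order 1 (of_nat k * a)" if "boundary_order 1 a" for k a
    using boundary_order_mult[OF boundary_order_of_nat that] by simp
  have two: "boundary_order 1 (2 * a)" if "boundary_order 1 a" for a
    using scale[OF that, of 2] by simp
  have B1: "boundary_order 1 ((- 1) ^ i * (der ^^ i) (coord * sf.p ^ ?m) * (der ^^ (2 * ?m - 1 - i)) w)"
    if "i \<in> {..<2 * ?m}" for i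
    using boundary_order_mult[OF boundary_order_mult[OF boundary_order_sign[of i]
        boundary_order_funpow_der[OF xp, of i]] boundary_order_funpow_der[OF w, of "2 * ?m - 1 - i"]] that
    by (simp add: algebra_simps of_nat_diff)
  have B2: "boundary_order 1 ((- 1) ^ i * (der ^^ i) (coord * w) * (der ^^ (l - 1 - i)) ((der ^^ ?m) w))"
    if "i \<in> {..<l}" for i
    using boundary_order_mono[OF boundary_order_mult[OF boundary_order_mult[OF boundary_order_sign[of i]
        boundary_order_funpow_der[OF xw, of i]] boundary_order_funpow_der[OF W, of "l - 1 - i"]], of 1] that
    by (simp add: algebra_simps of_nat_diff)
  have ZV: "boundary_order 1 (2 * (der ^^ l) (coord * w) * (der ^^ l) w)"
    using two[OF boundary_order_mono[OF boundary_order_mult[OF Z V]]] by (simp add: mult.assoc)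
  have xV: "boundary_order 1 (coord * ((der ^^ l) w)\<^sup>2)"
    using boundary_order_mono[OF boundary_order_mult[OF boundary_order_coord boundary_order_power[OF V, of 2]], of 1]
    by simp
  have rest: "boundary_order 1 (of_nat (2 * ?m) * (- 1) ^ l *
      (2 * (der ^^ l) (coord * w) * (der ^^ l) w - coord * ((der ^^ l) w)\<^sup>2))"
    using scale[OF boundary_order_mult[OF boundary_order_sign[of l] boundary_order_diff[OF ZV xV], simplified], of "2 * ?m"]
    by (simp only: mult.assoc)
  show ?thesis
    unfolding sf.flux_def mult.assoc[of 2 "of_nat _"]
    by (intro boundary_order_diff two scale boundary_order_sum B1 B2 rest) assumption+
qed

lemma der_eq_zero_imp_eq_zero: "boundary_order 1 a \<Longrightarrow> der a = 0 \<Longrightarrow> a = 0"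
  by (rule monotone_vanishing_boundary) simp_all

text \<open>Descends one derivative at a time: up to index l the iterated derivatives of
  \<open>w\<close> have order at least 1, so every constant of integration is zero.\<close>

lemma funpow_der_eq_zero:
  assumes w: "boundary_order (2 * int l + 1) w" and "(der ^^ l) w = 0"
  shows "w = 0"
proof -
  have "j \<le> l \<Longrightarrow> (der ^^ j) w = 0 \<Longrightarrow> w = 0" for j
  proof (induction j)
    case (Suc j)
    have "boundary_order 1 ((der ^^ j) w)"
      using boundary_order_mono[OF boundary_order_funpow_der[OF w, of j], of 1] Suc.prems by simp
    then have "(der ^^ j) w = 0"
      by (rule der_eq_zero_imp_eq_zero) (use Suc.prems(2) in simp)
    with Suc.prems(1) show ?case by (intro Suc.IH) simp_all
  qed simp
  from this[OF order_refl assms(2)] show ?thesis .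
qed

lemma rigidity:
  fixes w :: smooth_fun and l :: nat
  defines "m \<equiv> Suc l"
  assumes w: "boundary_order (2 * int l + 1) w"
    and eq: "sf.p ^ m * (der ^^ (2 * m)) w
      = of_nat (2 * m) * w * (der ^^ (2 * m - 1)) w + (- 1) ^ m * of_nat (fact (2 * m + 1)) * w"
  shows "w = 0"
proof -
  let ?S = "(- 1) ^ l :: smooth_fun" and ?V = "(der ^^ l) w" and ?N = "2 * m * (2 * l + 1)"
  \<comment> \<open>The sign makes the derivative a nonnegative multiple of a square, so
    \<open>?B\<close> is monotone and hence zero; then the square vanishes as well.\<close>
  let ?B = "- ?S * sf.flux l w"
  have B: "boundary_order 1 ?B"
    using boundary_order_minus[OF boundary_order_mult[OF boundary_order_sign[of l] boundary_order_flux[OF w]]]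
    by simp
  have "der ?B = - ?S * der (sf.flux l w)"
    by (simp only: sf.mult sf.minus sf.power_sign) simp
  also have "\<dots> = (?S * ?S) * (of_nat ?N * ?V\<^sup>2)"
    unfolding sf.d_flux[OF eq[unfolded m_def]] m_def by (simp only: mult_minus_left mult_minus_right minus_minus mult.assoc)
  also have "?S * ?S = 1"
    by (simp flip: power_mult_distrib)
  finally have derB: "der ?B = of_nat ?N * ?V\<^sup>2" by simp
  have ev: "ev (der ?B) x = real ?N * (ev ?V x)\<^sup>2" if "x \<in> {-1<..<1}" for x
    unfolding derB using that by (simp only: ev_simps)
  have "?B = 0"
    by (rule monotone_vanishing_boundary[OF B]) (simp only: ev, simp)
  then have "der ?B = 0" by simp
  then have "real ?N * (ev ?V x)\<^sup>2 = 0" if "x \<in> {-1<..<1}" for x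
    using ev[OF that] by simp
  moreover have "real ?N \<noteq> 0" unfolding of_nat_eq_0_iff by (simp add: m_def)
  ultimately have "ev ?V x = 0" if "x \<in> {-1<..<1}" for x
    using that by (simp only: mult_eq_0_iff power_eq_0_iff) blast
  then have "?V = 0" by (intro smooth_fun_eqI) simp
  with w show ?thesis by (rule funpow_der_eq_zero)
qed

section \<open>Transfer from the sphere to the ring and conclusion\<close>

lemma gjms_factor_zonal:
  fixes u :: "'a::euclidean_space \<Rightarrow> real"
  assumes e: "norm e = 1" and dim: "DIM('a) = n + 1" and u: "zonal e u (ev a)"
  shows "zonal e (gjms_factor n j u) (ev (sf.zonal_factor n j a))"
  unfolding zonal_def
proof (intro ballI impI)
  fix \<xi> :: 'a assume \<xi>: "\<xi> \<in> sphere 0 1" "\<xi> \<bullet> e \<in> {-1<..<1}"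
  note lap = sphere_laplacian_zonal[OF e smooth_ev u \<xi>]
  have "sphere_laplacian u \<xi> = (1 - (\<xi> \<bullet> e)\<^sup>2) * ev (der (der a)) (\<xi> \<bullet> e)
      - real n * (\<xi> \<bullet> e) * ev (der a) (\<xi> \<bullet> e)"
    unfolding lap dim ev_der_der[OF \<xi>(2), symmetric] ev_der[OF \<xi>(2), symmetric] by simp
  moreover have "u \<xi> = ev a (\<xi> \<bullet> e)" using u \<xi> by (simp add: zonal_def)
  ultimately show "gjms_factor n j u \<xi> = ev (sf.zonal_factor n j a) (\<xi> \<bullet> e)"
    unfolding gjms_factor_def sf.zonal_factor_def sf.zonal_laplacian_def
    by (simp only: ev_simps ev_coord \<xi>(2)) simp
qed

lemma gjms_zonal:
  fixes u :: "'a::euclidean_space \<Rightarrow> real"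
  assumes "norm e = 1" "DIM('a) = 2 * m + 1" "zonal e u (ev a)" "0 < m"
  shows "zonal e (gjms (2 * m) u) (ev ((- 1) ^ m * (der ^^ (2 * m - 1)) (sf.p ^ m * der a)))"
proof -
  have "zonal e (foldr (gjms_factor (2 * m)) js u) (ev (foldr (sf.zonal_factor (2 * m)) js a))" for js
    by (induction js) (simp_all add: assms(3) gjms_factor_zonal[OF assms(1,2)])
  from this[of "[0..<m]"] have "zonal e (gjms (2 * m) u) (ev (foldr (sf.zonal_factor (2 * m)) [0..<m] a))"
    by (simp add: gjms_def)
  then show ?thesis
    unfolding sf.foldr_zonal_factor_rodrigues[OF surj_der assms(4)] .
qed

lemma mean_field_constant:
  fixes a :: smooth_fun and m :: nat
  assumes m: "0 < m" and a: "boundary_order (- 1) (der a)"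
    and eq: "\<And>x. x \<in> {-1<..<1} \<Longrightarrow> ev ((- 1) ^ m * (der ^^ (2 * m - 1)) (sf.p ^ m * der a)) x
        = (2 * real m + 1) * fact (2 * m - 1) * (exp (2 * real m * ev a x) - 1)"
  shows "a = 0"
proof -
  obtain l where l: "m = Suc l" using m by (cases m) auto
  define w y S where "w = sf.p ^ m * der a" and "y = (der ^^ (2 * m - 1)) w" and "S = ((- 1) ^ m :: smooth_fun)"
  \<comment> \<open>The constant on the right after multiplying the equation by n + 1, where n =
    2m.\<close>
  define c :: nat where "c = (2 * m + 1) * fact (2 * m - 1)"
  have SS: "S * S = 1" by (simp add: S_def flip: power_mult_distrib)
  have c: "real c = (2 * real m + 1) * fact (2 * m - 1)" by (simp add: c_def algebra_simps)
  have Sy: "ev (S * y) x = real c * (exp (2 * real m * ev a x) - 1)" if "x \<in> {-1<..<1}" for x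
    using eq[OF that] unfolding c S_def y_def w_def .
  \<comment> \<open>Differentiation eliminates the exponential: by the equation, c exp(n a) equals
    \<open>S * y + of_nat c\<close>.\<close>
  have "der (S * y) = of_nat (2 * m) * der a * (S * y + of_nat c)"
  proof (rule der_eqI)
    fix x :: real assume x: "x \<in> {-1<..<1}"
    have "((\<lambda>x. real c * (exp (2 * real m * ev a x) - 1)) has_real_derivative
        real c * (exp (2 * real m * ev a x) * (2 * real m * ev (der a) x))) (at x)"
      by (auto intro!: derivative_eq_intros ev_has_deriv[OF x])
    then have "(ev (S * y) has_real_derivative
        real c * (exp (2 * real m * ev a x) * (2 * real m * ev (der a) x))) (at x)"
      by (rule has_field_derivative_transform_within_open[OF _ open_greaterThanLessThan x]) (simp only: Sy)
    also have "real c * (exp (2 * real m * ev a x) * (2 * real m * ev (der a) x))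
        = ev (of_nat (2 * m) * der a * (S * y + of_nat c)) x"
      by (simp only: ev_mult[of _ "_ + _"] ev_mult[of "of_nat _"] ev_add ev_of_nat[OF x] Sy[OF x])
        (simp add: algebra_simps)
    finally show "(ev (S * y) has_real_derivative ev (of_nat (2 * m) * der a * (S * y + of_nat c)) x) (at x)" .
  qed
  moreover have w': "(der ^^ (2 * m)) w = der y"
    by (simp add: y_def l)
  have "der (S * y) = S * (der ^^ (2 * m)) w"
    unfolding w' S_def by (simp only: sf.mult sf.power_sign) simp
  ultimately have S_eq: "S * (der ^^ (2 * m)) w = of_nat (2 * m) * der a * (S * y + of_nat c)"
    by simp
  \<comment> \<open>The sign \<open>S\<close> is its own inverse.\<close>
  have "(der ^^ (2 * m)) w = S * (S * (der ^^ (2 * m)) w)"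
    by (simp only: mult.assoc[symmetric] SS mult_1)
  also have "\<dots> = of_nat (2 * m) * der a * (S * S * y + S * of_nat c)"
    unfolding S_eq by (simp only: algebra_simps)
  finally have "sf.p ^ m * (der ^^ (2 * m)) w = sf.p ^ m * (of_nat (2 * m) * der a * (y + S * of_nat c))"
    by (simp only: SS mult_1)
  also have "\<dots> = of_nat (2 * m) * w * y + S * of_nat (2 * m * c) * w"
    by (simp only: w_def of_nat_mult algebra_simps)
  \<comment> \<open>With n = 2m this reads n (n + 1) (n - 1)! = (n + 1)!, the exact constant
    required by \<open>rigidity\<close>.\<close>
  also have "2 * m * c = fact (2 * m + 1)"
    using fact_reduce[of "2 * m", where 'a=nat] m by (simp add: c_def algebra_simps)
  finally have "sf.p ^ Suc l * (der ^^ (2 * Suc l)) w = of_nat (2 * Suc l) * w * (der ^^ (2 * Suc l - 1)) w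
      + (- 1) ^ Suc l * of_nat (fact (2 * Suc l + 1)) * w"
    unfolding y_def S_def l .
  moreover have "boundary_order (2 * int l + 1) w"
    unfolding w_def using boundary_order_mult[OF boundary_order_power[OF boundary_order_p, of m] a]
    by (simp add: l algebra_simps)
  ultimately have "w = 0" by (intro rigidity[of l])
  \<comment> \<open>Put back into the undifferentiated equation, this forces exp(n a) = 1, so
    \<open>a\<close> is zero and not merely constant.\<close>
  then have "y = 0" by (simp add: y_def sf.funpow_zero)
  show ?thesis
  proof (rule smooth_fun_eqI)
    fix x :: real assume x: "x \<in> {-1<..<1}"
    have "real c * (exp (2 * real m * ev a x) - 1) = 0"
      using Sy[OF x] \<open>y = 0\<close> by simp
    moreover have "real c \<noteq> 0" unfolding of_nat_eq_0_iff by (simp add: c_def)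
    ultimately show "ev a x = ev 0 x" using m by simp
  qed
qed

theorem theorem2:
  fixes n :: nat and u :: "real ^ 'm \<Rightarrow> real"
  assumes "even n" and "0 < n" and "CARD('m) = n + 1"
    and "smooth_on_sphere u"
    and "axially_symmetric u"
    and "\<forall>\<xi>\<in>sphere 0 1. 1 / (real n + 1) * gjms n u \<xi> = fact (n - 1) * (exp (real n * u \<xi>) - 1)"
  shows "\<forall>\<xi>\<in>sphere 0 1. u \<xi> = 0"
proof
  obtain m where m: "n = 2 * m" "0 < m" using assms(1,2) by (auto elim: evenE)
  obtain e and f0 :: "real \<Rightarrow> real" where e: "norm e = 1"
    and f0: "\<And>\<xi>. \<xi> \<in> sphere 0 1 \<Longrightarrow> u \<xi> = f0 (\<xi> \<bullet> e)"
    using assms(5) unfolding axially_symmetric_def by blast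
  have dim: "DIM(real ^ 'm) = 2 * m + 1" using assms(3) m by simp
  \<comment> \<open>A direction orthogonal to the axis; together with \<open>e\<close> it spans the
    plane of a great circle through both poles.\<close>
  obtain v0 :: "real ^ 'm" where v0: "v0 \<noteq> 0" "orthogonal e v0"
    using orthogonal_to_vector_exists[of e] dim m by auto
  define v where "v = v0 /\<^sub>R norm v0"
  have [simp]: "e \<bullet> e = 1" "v \<bullet> v = 1" "e \<bullet> v = 0" "v \<bullet> e = 0"
    using e v0 by (simp_all add: v_def orthogonal_def dot_square_norm inner_commute power2_eq_square)
  have circle: "s *\<^sub>R e + t *\<^sub>R v \<in> sphere 0 1" if "s\<^sup>2 + t\<^sup>2 = 1" for s t
  proof -
    have "(s *\<^sub>R e + t *\<^sub>R v) \<bullet> (s *\<^sub>R e + t *\<^sub>R v) = 1"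
      using that by (simp add: inner_add_left inner_add_right power2_eq_square)
    then show ?thesis by (simp add: norm_eq_1)
  qed
  have height: "(s *\<^sub>R e + t *\<^sub>R v) \<bullet> e = s" for s t
    by (simp add: inner_add_left)

  \<comment> \<open>The profile \<open>f0\<close> carries no regularity of its own. In terms of the
    angle, \<open>u\<close> along the great circle is smooth through the poles, which supplies the
    boundary behaviour.\<close>
  define g where "g = (\<lambda>\<theta>. u (cos \<theta> *\<^sub>R e + sin \<theta> *\<^sub>R v))"
  have g: "smooth UNIV g"
    unfolding g_def by (intro smooth_sphere_compose[OF assms(4)] open_UNIV smooth_cos smooth_sin circle) simp
  have g_eq: "g \<theta> = f0 (cos \<theta>)" for \<theta>
    unfolding g_def by (subst f0[OF circle]) (simp_all add: height)

  \<comment> \<open>The same restriction in terms of the height, smooth only away from the poles; it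
    represents \<open>f0\<close> in the ring.\<close>
  define f where "f = (\<lambda>t. u (t *\<^sub>R e + sqrt (1 - t\<^sup>2) *\<^sub>R v))"
  have on_circle: "t\<^sup>2 + (sqrt (1 - t\<^sup>2))\<^sup>2 = 1" if "t \<in> {-1<..<1}" for t :: real
    using that abs_square_less_1[of t] by (simp add: abs_less_iff)
  have f: "smooth {-1<..<1} f"
    unfolding f_def
    by (intro smooth_sphere_compose[OF assms(4)] open_greaterThanLessThan smooth_ident
        smooth_sqrt_one_minus_sq circle on_circle) simp_all
  have f_eq: "f t = f0 t" if "t \<in> {-1<..<1}" for t
    unfolding f_def by (subst f0[OF circle[OF on_circle[OF that]]]) (simp add: height)

  define a where "a = restrict_smooth f"
  have ev_a: "ev a t = f0 t" if "t \<in> {-1<..<1}" for t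
    using that f by (simp add: a_def ev_restrict_smooth f_eq)
  have u: "zonal e u (ev a)"
    using f0 ev_a by (simp add: zonal_def)
  have "a = 0"
  proof (rule mean_field_constant[OF m(2)])
    show "boundary_order (- 1) (der a)"
      by (rule boundary_order_der_even[OF g]) (simp only: g_eq ev_a cos_in_interval)
    fix t :: real assume t: "t \<in> {-1<..<1}"
    let ?\<xi> = "t *\<^sub>R e + sqrt (1 - t\<^sup>2) *\<^sub>R v"
    have \<xi>: "?\<xi> \<in> sphere 0 1" "?\<xi> \<bullet> e \<in> {-1<..<1}"
      using circle[OF on_circle[OF t]] t by (simp_all only: height)
    have "1 / (real n + 1) * gjms n u ?\<xi> = fact (n - 1) * (exp (real n * u ?\<xi>) - 1)"
      using assms(6) \<xi>(1) by blast
    moreover have "u ?\<xi> = ev a t" using u \<xi> height unfolding zonal_def by metis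
    ultimately have "gjms (2 * m) u ?\<xi> = (2 * real m + 1) * fact (2 * m - 1) * (exp (2 * real m * ev a t) - 1)"
      unfolding m(1) by (simp add: field_simps)
    moreover have "gjms (2 * m) u ?\<xi> = ev ((- 1) ^ m * (der ^^ (2 * m - 1)) (sf.p ^ m * der a)) t"
      using gjms_zonal[OF e dim u m(2)] \<xi> height unfolding zonal_def by metis
    ultimately show "ev ((- 1) ^ m * (der ^^ (2 * m - 1)) (sf.p ^ m * der a)) t
        = (2 * real m + 1) * fact (2 * m - 1) * (exp (2 * real m * ev a t) - 1)"
      by (simp only:)
  qed
  then have interior: "u \<xi> = 0" if "\<xi> \<in> sphere 0 1" "\<xi> \<bullet> e \<in> {-1<..<1}" for \<xi>
    using u that by (simp add: zonal_def)
  \<comment> \<open>The ring sees only the open interval; the poles are reached by continuity along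
    the great circle.\<close>
  have "g \<theta> = 0" if "\<theta> \<in> {0..pi}" for \<theta>
  proof (rule continuous_constant_on_closure[of "{0<..<pi}" g])
    show "continuous_on (closure {0<..<pi}) g"
      by (rule continuous_on_subset[OF smooth_continuous_on[OF g]]) simp
    show "g \<theta> = 0" if "\<theta> \<in> {0<..<pi}" for \<theta>
      unfolding g_def using cos_in_interval[OF that]
      by (intro interior circle) (simp_all add: height)
    show "\<theta> \<in> closure {0<..<pi}" using that by simp
  qed
  then have poles: "f0 1 = 0" "f0 (- 1) = 0"
    using g_eq[of 0] g_eq[of pi] by simp_all
  fix \<xi> :: "real ^ 'm" assume \<xi>: "\<xi> \<in> sphere 0 1"
  have "\<bar>\<xi> \<bullet> e\<bar> \<le> 1" using Cauchy_Schwarz_ineq2[of \<xi> e] \<xi> e by simp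
  then consider "\<xi> \<bullet> e = 1" | "\<xi> \<bullet> e = - 1" | "\<xi> \<bullet> e \<in> {-1<..<1}" by fastforce
  then show "u \<xi> = 0" by cases (use f0[OF \<xi>] poles interior[OF \<xi>] in simp_all)
qed

end
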